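(* Let $w(z):\Omega_z\to\widehat{\mathbb C}_w$ be a Speiser function provided with a cyclic order $\mathcal W_{\tt q}$ for its ${\tt q}$ singular values. Consider the action $$Aut(\Omega_z)\times\mathrm{Stab}(\mathcal W_{\tt q})\times(\Omega_z\times\widehat{\mathbb C}_w)\longrightarrow\Omega_z\times\widehat{\mathbb C}_w,\qquad(g,h,z,w)\longmapsto(g(z),h(w)).$$ Each non-trivial element in $Aut(\Omega_z)\times\mathrm{Stab}(\mathcal W_{\tt q})$ provides a different function with the same $\mathcal W_{\tt q}$. i) Since $Aut(\Omega_z)$ is a Lie group, it gives rise to an infinite number of functions. ii) For the group $\mathrm{Stab}(\mathcal W_{\tt q})$ we have the following cases (up to conjugation in $Aut(\widehat{\mathbb C}_w)$): - if ${\tt q}=2$ and $\mathrm{Stab}(\mathcal W_{\tt q})\ne Id$, then $\mathrm{Stab}(\mathcal W_{\tt q})\cong\mathbb C^*$ are the homotheties; - if ${\tt q}\ge3$ and $\mathrm{Stab}(\mathcal W_{\tt q})\ne Id$, then $\mathrm{Stab}(\mathcal W_{\tt q})$ is one of the finite subgroups of $PSL(2,\mathbb C)$.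
   Context: $\Omega_z$ is a simply connected Riemann surface ($\widehat{\mathbb C}_z$, $\mathbb C_z$ or the unit disk $\Delta_z$; in the last two cases $w$ is assumed to have $\infty$, resp. $\{|z|=1\}$, as natural boundary). A Speiser function is a meromorphic function $w:\Omega_z\to\widehat{\mathbb C}_w$ with a finite number ${\tt q}\ge2$ of distinct singular (critical or asymptotic) values; a cyclic order of them is written $\mathcal W_{\tt q}=[{\tt w}_1,\dots,{\tt w}_{\tt q}]$. $\mathrm{Stab}(\mathcal W_{\tt q})$ is the isotropy group of $\mathcal W_{\tt q}$: the subgroup of $Aut(\widehat{\mathbb C}_w)$ that leaves invariant the set $\{{\tt w}_{\tt j}\}_{{\tt j}=1}^{\tt q}$ and also preserves the chosen cyclic order on them. The action extends to functions as $(g,h,w(z))\mapsto h(w(g(z)))$.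
   Formalization: "Each non-trivial element provides a different function" fails for w=exp, g=z+2πi; proved: it changes some function in the orbit of w, distinct h differ, for each h only countably many g fix w. For q=2 the order is directed (no exchange), else Stab is not C*. Lie group remark omitted. *)

theory Defs
  imports "HOL-Complex_Analysis.Complex_Analysis" "HOL-Algebra.Algebra"
begin

text \<open>The point at infinity is \<^term>\<open>None\<close>.\<close>

type_synonym sphere = "complex option"

abbreviation sphere_top :: "sphere topology" where
  "sphere_top \<equiv> Alexandroff_compactification euclidean"

text \<open>
  The standard atlas: the coordinate \<open>z\<close> is used around a finite point and \<open>1/z\<close> around
  infinity.  The first argument is only there to select one of the two charts.  The values
  \<open>chart (Some a) None\<close> and \<open>chart None (Some 0)\<close> lie outside the chart domains and are
  irrelevant junk.
\<close>

fun chart :: "sphere \<Rightarrow> sphere \<Rightarrow> complex" where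
  "chart (Some a) (Some z) = z"
| "chart (Some a) None = 0"
| "chart None (Some z) = inverse z"
| "chart None None = 0"

fun unchart :: "sphere \<Rightarrow> complex \<Rightarrow> sphere" where
  "unchart (Some a) u = Some u"
| "unchart None u = (if u = 0 then None else Some (inverse u))"

text \<open>The expression of \<open>f\<close> in the charts selected by \<open>p\<close> and \<open>f p\<close>.\<close>

definition local_rep :: "(sphere \<Rightarrow> sphere) \<Rightarrow> sphere \<Rightarrow> complex \<Rightarrow> complex" where
  "local_rep f p = (\<lambda>u. chart (f p) (f (unchart p u)))"

text \<open>
  Holomorphic maps from an open subset \<open>S\<close> of the sphere to the sphere.  Continuity ensures that
  \<open>f\<close> stays in the selected chart near \<open>p\<close>.  For \<open>S\<close> in the finite plane these are the
  meromorphic functions on \<open>S\<close>, together with the constant infinity.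
\<close>

definition holomorphic_map_on :: "sphere set \<Rightarrow> (sphere \<Rightarrow> sphere) \<Rightarrow> bool" where
  "holomorphic_map_on S f \<longleftrightarrow>
     continuous_map (subtopology sphere_top S) sphere_top f \<and>
     (\<forall>p\<in>S. local_rep f p analytic_on {chart p p})"

definition model_surfaces :: "sphere set set" where
  "model_surfaces = {UNIV, range Some, Some ` ball 0 1}"

text \<open>
  Following \<^const>\<open>BijGroup\<close>, automorphisms of \<open>S\<close> are extensional functions (undefined
  outside \<open>S\<close>), so that equality of automorphisms is equality on \<open>S\<close>.
\<close>

definition Aut :: "sphere set \<Rightarrow> (sphere \<Rightarrow> sphere) set" where
  "Aut S = {g \<in> Bij S. holomorphic_map_on S g \<and> holomorphic_map_on S (inv_into S g)}"

definition AutGroup :: "sphere set \<Rightarrow> (sphere \<Rightarrow> sphere) monoid" where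
  "AutGroup S = (BijGroup S)\<lparr>carrier := Aut S\<rparr>"

text \<open>Multiple poles count as critical points, with critical value infinity.\<close>

definition critical_values :: "sphere set \<Rightarrow> (sphere \<Rightarrow> sphere) \<Rightarrow> sphere set" where
  "critical_values S f = {f p | p. p \<in> S \<and> deriv (local_rep f p) (chart p p) = 0}"

text \<open>
  \<open>a\<close> is an asymptotic value if \<open>f\<close> tends to \<open>a\<close> along a path in \<open>S\<close> that tends to the ideal
  boundary of \<open>S\<close>, i.e. eventually leaves every compact subset of \<open>S\<close>.
\<close>

definition asymptotic_values :: "sphere set \<Rightarrow> (sphere \<Rightarrow> sphere) \<Rightarrow> sphere set" where
  "asymptotic_values S f =
     {a. \<exists>\<gamma>. continuous_map (top_of_set {0::real..}) (subtopology sphere_top S) \<gamma> \<and>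
             (\<forall>K. compactin sphere_top K \<and> K \<subseteq> S \<longrightarrow> (\<forall>\<^sub>F t in at_top. \<gamma> t \<notin> K)) \<and>
             limitin sphere_top (f \<circ> \<gamma>) a at_top}"

definition singular_values :: "sphere set \<Rightarrow> (sphere \<Rightarrow> sphere) \<Rightarrow> sphere set" where
  "singular_values S f = critical_values S f \<union> asymptotic_values S f"

text \<open>
  The boundary of \<open>S\<close> in the sphere is a natural boundary of \<open>f\<close>: no boundary point has a
  neighbourhood to which \<open>f\<close> extends meromorphically.  The boundary is the point at infinity for
  the plane and the unit circle for the disk; for the whole sphere the condition is void.
\<close>

definition natural_boundary :: "sphere set \<Rightarrow> (sphere \<Rightarrow> sphere) \<Rightarrow> bool" where
  "natural_boundary S f \<longleftrightarrow>
     (\<forall>\<zeta> \<in> sphere_top frontier_of S.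
        \<not> (\<exists>U F. openin sphere_top U \<and> \<zeta> \<in> U \<and> holomorphic_map_on U F \<and>
                 (\<forall>z \<in> U \<inter> S. F z = f z)))"

definition speiser_function :: "sphere set \<Rightarrow> (sphere \<Rightarrow> sphere) \<Rightarrow> bool" where
  "speiser_function S f \<longleftrightarrow>
     holomorphic_map_on S f \<and> natural_boundary S f \<and>
     finite (singular_values S f) \<and> card (singular_values S f) \<ge> 2"

text \<open>A cyclic order \<open>[w\<^sub>1, \<dots>, w\<^sub>q]\<close> is given by a list, taken up to rotation.\<close>

definition cyclic_order_of :: "sphere list \<Rightarrow> sphere set \<Rightarrow> (sphere \<Rightarrow> sphere) \<Rightarrow> bool" where
  "cyclic_order_of ws S f \<longleftrightarrow> distinct ws \<and> set ws = singular_values S f"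

text \<open>
  Two enumerations give the same cyclic order if they differ by a rotation.  The case of two
  values needs a convention: up to rotation a two-element set has just one cyclic order, so that
  exchanging the two values would go unnoticed and the isotropy group would be an extension of
  the homotheties by the involution \<open>z \<mapsto> 1/z\<close>.  Here \<open>[w\<^sub>1, w\<^sub>2]\<close> is regarded as directed from
  \<open>w\<^sub>1\<close> to \<open>w\<^sub>2\<close>, and \<open>[w\<^sub>2, w\<^sub>1]\<close> as the reversed order.
\<close>

definition same_cyclic_order :: "'a list \<Rightarrow> 'a list \<Rightarrow> bool" where
  "same_cyclic_order us vs \<longleftrightarrow>
     (if length vs = 2 then us = vs else (\<exists>k. us = rotate k vs))"

definition Stab :: "sphere list \<Rightarrow> (sphere \<Rightarrow> sphere) set" where
  "Stab ws = {h \<in> Aut UNIV. h ` set ws = set ws \<and> same_cyclic_order (map h ws) ws}"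

definition StabGroup :: "sphere list \<Rightarrow> (sphere \<Rightarrow> sphere) monoid" where
  "StabGroup ws = (AutGroup UNIV)\<lparr>carrier := Stab ws\<rparr>"

definition product_action ::
  "sphere set \<Rightarrow> (sphere \<Rightarrow> sphere) \<times> (sphere \<Rightarrow> sphere) \<Rightarrow> sphere \<times> sphere \<Rightarrow> sphere \<times> sphere" where
  "product_action S = (\<lambda>(g, h). \<lambda>(z, w) \<in> S \<times> UNIV. (g z, h w))"

text \<open>The function \<open>h(f(g(z)))\<close>, extensional on \<open>S\<close>.\<close>

definition transform ::
  "sphere set \<Rightarrow> (sphere \<Rightarrow> sphere) \<Rightarrow> (sphere \<Rightarrow> sphere) \<Rightarrow> (sphere \<Rightarrow> sphere) \<Rightarrow> sphere \<Rightarrow> sphere" where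
  "transform S g h f = (\<lambda>z\<in>S. h (f (g z)))"

definition Cstar :: "complex monoid" where
  "Cstar = \<lparr>carrier = - {0}, mult = (*), one = 1\<rparr>"

definition homotheties :: "(sphere \<Rightarrow> sphere) set" where
  "homotheties = {map_option ((*) c) | c. c \<noteq> 0}"

definition SL2C :: "(complex^2^2) monoid" where
  "SL2C = \<lparr>carrier = {A. det A = 1}, mult = (**), one = mat 1\<rparr>"

definition PSL2C :: "(complex^2^2) set monoid" where
  "PSL2C = SL2C Mod {mat 1, - mat 1}"

fun moebius :: "complex^2^2 \<Rightarrow> sphere \<Rightarrow> sphere" where
  "moebius A (Some z) =
     (if A$2$1 * z + A$2$2 = 0 then None
      else Some ((A$1$1 * z + A$1$2) / (A$2$1 * z + A$2$2)))"
| "moebius A None = (if A$2$1 = 0 then None else Some (A$1$1 / A$2$1))"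

text \<open>
  The set of maps of the sphere given by a set \<open>K\<close> of elements of \<open>PSL(2, \<complex>)\<close>; these elements
  are the cosets \<open>{A, -A}\<close>, and both matrices of a coset give the same map.
\<close>

definition moebius_maps :: "(complex^2^2) set set \<Rightarrow> (sphere \<Rightarrow> sphere) set" where
  "moebius_maps K = moebius ` \<Union>K"

definition conjugate_by :: "(sphere \<Rightarrow> sphere) \<Rightarrow> (sphere \<Rightarrow> sphere) set \<Rightarrow> (sphere \<Rightarrow> sphere) set" where
  "conjugate_by m H = {m \<circ> h \<circ> inv_into UNIV m | h. h \<in> H}"

end

theory Submission
  imports Defs "HOL-Computational_Algebra.Fundamental_Theorem_Algebra"
begin

text \<open>
  Every automorphism of a model surface is the restriction of a Moebius map of the sphere that
  preserves the surface.  Hence it permutes the ideal boundary points and carries meromorphic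
  extensions along, so that \<open>h \<circ> w \<circ> g\<close> again has a natural boundary; by the chain rule and
  transport of paths its singular values are the \<open>h\<close>-images of those of \<open>w\<close>.

  The fibres of the nonconstant map \<open>w\<close> are countable, so \<open>w\<close> takes infinitely many values on every
  circle around \<open>0\<close>.  Composing \<open>w\<close> with rotations gives infinitely many functions, and since an
  automorphism is determined by its values at three points, \<open>w\<close> has only countably many symmetries.

  A Moebius map fixing two points is a homothety after conjugation, and one fixing three points is
  the identity.  So the stabilizer of at least three values is finite, and it is a subgroup of
  \<open>PSL(2, \<complex>)\<close> because \<open>\<plusminus>1\<close> is the kernel of the action of \<open>SL(2, \<complex>)\<close> on the sphere.
\<close>

text \<open>A nontrivial pair can leave a given function unchanged: \<open>exp\<close> has the two
  singular values 0 and infinity and is invariant under z -> z + 2 pi i. That nontrivial elements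
  give different functions is therefore proved in several forms: no nontrivial pair fixes every
  function of the orbit, for fixed \<open>g\<close> the function determines \<open>h\<close>, and
  for fixed \<open>h\<close> only countably many \<open>g\<close> give back \<open>w\<close>. The
  obstacle in the transport is the natural boundary. An automorphism is given on \<open>S\<close>
  only, while an extension of \<open>w\<close> lives around a boundary point, so \<open>g\<close> is
  needed beyond \<open>S\<close>. This is why the automorphisms have to be classified; for critical
  and asymptotic values an inverse on \<open>S\<close> suffices. Two devices keep infinity from
  multiplying the cases. Analytic statements concern germs: \<open>represents L f p\<close> says
  that an analytic \<open>L\<close> describes \<open>f\<close> near \<open>p\<close> in the charts
  of \<open>p\<close> and \<open>f p\<close>, and germs compose without transition maps. Moebius
  maps are computed in homogeneous coordinates \<open>proj x y\<close>, where they are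
  linear.\<close>

no_notation fps_nth (infixl \<open>$\<close> 75)

section \<open>Holomorphic maps in charts\<close>

text \<open>Compact subsets of the plane are closed, so the two conditions on the removed set in the
  library description reduce to one. Working with the trace in the plane turns statements about
  neighbourhoods of infinity into bounds on norms.\<close>

lemma openin_sphere_iff:
  "openin sphere_top U \<longleftrightarrow> open (Some -` U) \<and> (None \<in> U \<longrightarrow> compact (- (Some -` U)))"
proof
  assume "openin sphere_top U"
  then consider V where "open V" "U = Some ` V" 
    | C where "compact C" "closed C" "U = insert None (Some ` (- C))"
    unfolding openin_Alexandroff_compactification by (auto simp: Compl_eq_Diff_UNIV)
  then show "open (Some -` U) \<and> (None \<in> U \<longrightarrow> compact (- (Some -` U)))"
  proof cases
    case 1
    moreover have "Some -` U = V" unfolding 1 by auto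
    ultimately show ?thesis by auto
  next
    case 2
    have "Some -` U = - C" unfolding 2 by auto
    then show ?thesis using 2 by auto
  qed
next
  assume *: "open (Some -` U) \<and> (None \<in> U \<longrightarrow> compact (- (Some -` U)))"
  show "openin sphere_top U"
  proof (cases "None \<in> U")
    case True
    have eq: "U = insert None (Some ` (UNIV - (- (Some -` U))))"
    proof (rule Set.set_eqI)
      fix x show "x \<in> U \<longleftrightarrow> x \<in> insert None (Some ` (UNIV - (- (Some -` U))))"
        using True by (cases x) auto
    qed
    have "compact (- (Some -` U))" "closed (- (Some -` U))"
      using * True by (auto simp: closed_Compl)
    then show ?thesis
      unfolding openin_Alexandroff_compactification topspace_euclidean using eq
      by (intro disjI2 exI[of _ "- (Some -` U)"]) simp
  next
    case False
    have eq: "U = Some ` (Some -` U)"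
    proof (rule Set.set_eqI)
      fix x show "x \<in> U \<longleftrightarrow> x \<in> Some ` (Some -` U)"
        using False by (cases x) auto
    qed
    then show ?thesis
      unfolding openin_Alexandroff_compactification using * by (auto intro!: disjI1)
  qed
qed

lemma unchart_chart [simp]: "unchart p (chart p p) = p"
  by (cases p) auto

lemma chart_unchart [simp]: "chart p (unchart p u) = u"
  by (cases p) auto

lemma open_unchart_vimage:
  assumes "openin sphere_top U"
  shows "open (unchart p -` U)"
proof (cases p)
  case (Some a)
  then have "unchart p -` U = Some -` U" by auto
  then show ?thesis using assms openin_sphere_iff by simp
next
  case None
  have V: "open (Some -` U)" using assms openin_sphere_iff by blast
  have punct: "open {u. u \<noteq> 0 \<and> Some (inverse u) \<in> U}"
  proof -
    have "open (inverse -` (Some -` U) \<inter> (- {0::complex}))"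
      by (subst Int_commute, rule continuous_open_preimage[OF _ _ V]) (auto intro!: continuous_intros)
    moreover have "inverse -` (Some -` U) \<inter> (- {0}) = {u. u \<noteq> 0 \<and> Some (inverse u) \<in> U}"
      by auto
    ultimately show ?thesis by simp
  qed
  show ?thesis
  proof (cases "None \<in> U")
    case False
    then have "unchart p -` U = {u. u \<noteq> 0 \<and> Some (inverse u) \<in> U}"
      using None by (auto split: if_splits)
    then show ?thesis using punct by simp
  next
    case True
    then have "bounded (- (Some -` U))"
      using assms openin_sphere_iff compact_imp_bounded by blast
    then obtain B where B: "B > 0" "\<And>x. x \<in> - (Some -` U) \<Longrightarrow> norm x \<le> B"
      by (meson bounded_pos)
    \<comment> \<open>\<open>B\<close> bounds the finite points missing from \<open>U\<close>, so a
      nonzero \<open>u\<close> with norm below \<open>inverse B\<close> has its reciprocal in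
      \<open>U\<close>. The ball takes care of the centre \<open>u = 0\<close>, where
      \<open>inverse\<close> is not continuous.\<close>
    have "unchart p -` U = ball 0 (inverse B) \<union> {u. u \<noteq> 0 \<and> Some (inverse u) \<in> U}"
    proof (rule Set.set_eqI)
      fix u
      have "Some (inverse u) \<in> U" if "u \<noteq> 0" "norm u < inverse B"
      proof (rule ccontr)
        assume "Some (inverse u) \<notin> U"
        then have "norm (inverse u) \<le> B" using B by auto
        then show False using that B(1) by (simp add: norm_inverse norm_divide field_simps)
      qed
      then show "u \<in> unchart p -` U \<longleftrightarrow> u \<in> ball 0 (inverse B) \<union> {u. u \<noteq> 0 \<and> Some (inverse u) \<in> U}"
        using None True B(1) by (cases "u = 0") auto
    qed
    then show ?thesis using punct by auto
  qed
qed

text \<open>With the preimage lemma before it, this makes \<open>unchart p\<close> a homeomorphism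
  onto an open part of the sphere. At infinity a ball of radius \<open>e\<close> around 0 covers all
  finite points of norm above \<open>inverse e\<close>, which bounds the points left out.\<close>

lemma openin_unchart_image:
  assumes "open V"
  shows "openin sphere_top (unchart p ` V)"
proof (cases p)
  case (Some a)
  then have "unchart p ` V = Some ` V" by auto
  then show ?thesis using assms by simp
next
  case None
  have eq: "Some -` (unchart p ` V) = inverse ` (V - {0})"
  proof (rule Set.set_eqI)
    fix x
    have "Some x = unchart p u \<longleftrightarrow> u \<noteq> 0 \<and> x = inverse u" for u
      using None by auto
    then show "x \<in> Some -` (unchart p ` V) \<longleftrightarrow> x \<in> inverse ` (V - {0})"
      by (auto simp: image_iff)
  qed
  have "inverse ` (V - {0}) = inverse -` V \<inter> (- {0})"
  proof (rule Set.set_eqI)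
    fix x
    show "x \<in> inverse ` (V - {0}) \<longleftrightarrow> x \<in> inverse -` V \<inter> (- {0})"
      using image_eqI[of x inverse "inverse x" "V - {0}"] by auto
  qed
  moreover have "open (inverse -` V \<inter> (- {0::complex}))"
    by (subst Int_commute, rule continuous_open_preimage[OF _ _ assms]) (auto intro!: continuous_intros)
  ultimately have o: "open (Some -` (unchart p ` V))" using eq by simp
  have "bounded (- (Some -` (unchart p ` V)))" if "None \<in> unchart p ` V"
  proof -
    have "0 \<in> V" using that None by (auto split: if_splits)
    then obtain e where e: "e > 0" "ball 0 e \<subseteq> V" using assms open_contains_ball by blast
    have "norm x \<le> inverse e" if "x \<notin> Some -` (unchart p ` V)" for x
    proof (rule ccontr)
      assume n: "\<not> norm x \<le> inverse e"
      then have x0: "x \<noteq> 0" using e by auto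
      have "inverse x \<in> V" using e n x0 by (auto simp: norm_inverse norm_divide field_simps intro!: subsetD[OF e(2)])
      then have "x \<in> inverse ` (V - {0})" using x0 by (intro image_eqI[of _ _ "inverse x"]) auto
      then show False using that eq by simp
    qed
    then show ?thesis unfolding bounded_iff by blast
  qed
  then show ?thesis unfolding openin_sphere_iff using o by (auto simp: compact_eq_bounded_closed closed_Compl)
qed

lemma topspace_sphere [simp]: "topspace sphere_top = UNIV"
  by (simp add: UNIV_option_conv)

text \<open>The library rule would compete with the form \<open>UNIV\<close> by expanding the space
  into infinity and the finite points.\<close>

declare topspace_Alexandroff_compactification [simp del]

text \<open>The bridge from the sphere to the plane: what holds eventually at \<open>p\<close>
  becomes a statement near \<open>chart p p\<close>, where complex analysis applies. It rests on
  \<open>unchart p\<close> being continuous and open.\<close>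

lemma nhdsin_sphere: "nhdsin sphere_top p = filtermap (unchart p) (nhds (chart p p))"
proof (rule filter_eqI)
  fix P
  show "eventually P (nhdsin sphere_top p) \<longleftrightarrow>
        eventually P (filtermap (unchart p) (nhds (chart p p)))"
  proof
    assume "eventually P (nhdsin sphere_top p)"
    then obtain U where U: "openin sphere_top U" "p \<in> U" "\<forall>x\<in>U. P x"
      by (auto simp: eventually_nhdsin)
    then show "eventually P (filtermap (unchart p) (nhds (chart p p)))"
      unfolding eventually_filtermap eventually_nhds
      by (intro exI[of _ "unchart p -` U"]) (auto simp: open_unchart_vimage)
  next
    assume "eventually P (filtermap (unchart p) (nhds (chart p p)))"
    then obtain V where V: "open V" "chart p p \<in> V" "\<forall>u\<in>V. P (unchart p u)"
      by (auto simp: eventually_filtermap eventually_nhds)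
    then have "p \<in> unchart p ` V" by (metis image_eqI unchart_chart)
    then show "eventually P (nhdsin sphere_top p)"
      unfolding eventually_nhdsin
      using V(3) openin_unchart_image[OF V(1), of p] by (intro disjI2 exI[of _ "unchart p ` V"]) blast
  qed
qed

text \<open>A germ of \<open>f\<close> in coordinates. Writing the equation with
  \<open>unchart\<close> on the target side also says that \<open>f\<close> stays in the chart
  around \<open>f p\<close>; an equation for \<open>local_rep\<close> alone would not, because of
  the junk values of \<open>chart\<close>.\<close>

definition represents :: "(complex \<Rightarrow> complex) \<Rightarrow> (sphere \<Rightarrow> sphere) \<Rightarrow> sphere \<Rightarrow> bool" where
  "represents L f p \<longleftrightarrow> L analytic_on {chart p p} \<and>
     (\<forall>\<^sub>F u in nhds (chart p p). f (unchart p u) = unchart (f p) (L u))"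

definition holomorphic_at :: "(sphere \<Rightarrow> sphere) \<Rightarrow> sphere \<Rightarrow> bool" where
  "holomorphic_at f p \<longleftrightarrow> (\<exists>L. represents L f p)"

lemma represents_eventually_local_rep:
  assumes "represents L f p"
  shows "\<forall>\<^sub>F u in nhds (chart p p). local_rep f p u = L u"
  using assms unfolding represents_def local_rep_def
  by (auto elim!: eventually_mono)

lemma represents_chart:
  assumes "represents L f p"
  shows "L (chart p p) = chart (f p) (f p)"
  using eventually_nhds_x_imp_x[OF represents_eventually_local_rep[OF assms]]
  by (simp add: local_rep_def)

lemma represents_deriv:
  assumes "represents L f p"
  shows "deriv (local_rep f p) (chart p p) = deriv L (chart p p)"
  using represents_eventually_local_rep[OF assms] by (rule deriv_cong_ev) simp

lemma represents_isCont:
  assumes "represents L f p"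
  shows "isCont L (chart p p)"
  using assms unfolding represents_def
  by (metis analytic_on_imp_differentiable_at field_differentiable_imp_continuous_at singletonI)

lemma represents_imp_limitin:
  assumes "represents L f p"
  shows "limitin sphere_top f (f p) (nhdsin sphere_top p)"
proof -
  have "eventually (\<lambda>x. f x \<in> U) (nhdsin sphere_top p)"
    if U: "openin sphere_top U" "f p \<in> U" for U
  proof -
    have "chart (f p) (f p) \<in> unchart (f p) -` U" using U by simp
    then have "\<forall>\<^sub>F v in nhds (chart (f p) (f p)). v \<in> unchart (f p) -` U"
      using open_unchart_vimage[OF U(1)] eventually_nhds_in_open by blast
    moreover have "filterlim L (nhds (chart (f p) (f p))) (nhds (chart p p))"
      using represents_isCont[OF assms] represents_chart[OF assms]
      by (metis isCont_def tendsto_nhds_iff)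
    ultimately have "\<forall>\<^sub>F u in nhds (chart p p). L u \<in> unchart (f p) -` U"
      by (rule eventually_compose_filterlim)
    moreover have "\<forall>\<^sub>F u in nhds (chart p p). f (unchart p u) = unchart (f p) (L u)"
      using assms by (simp add: represents_def)
    ultimately show ?thesis unfolding nhdsin_sphere eventually_filtermap
      by eventually_elim simp
  qed
  then show ?thesis by (simp add: limitin_def)
qed

lemma represents_local_rep:
  assumes "limitin sphere_top f (f p) (nhdsin sphere_top p)" "local_rep f p analytic_on {chart p p}"
  shows "represents (local_rep f p) f p"
proof -
  \<comment> \<open>The range of \<open>unchart (f p)\<close> is the domain of the target chart, an
    open neighbourhood of \<open>f p\<close>. Continuity keeps \<open>f\<close> in it near
    \<open>p\<close>, and there \<open>unchart\<close> undoes \<open>chart\<close>.\<close>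
  have "f p \<in> range (unchart (f p))" by (metis rangeI unchart_chart)
  then have "eventually (\<lambda>x. f x \<in> range (unchart (f p))) (nhdsin sphere_top p)"
    using assms(1) openin_unchart_image[OF open_UNIV] unfolding limitin_def by blast
  then have "\<forall>\<^sub>F u in nhds (chart p p). f (unchart p u) = unchart (f p) (local_rep f p u)"
    unfolding nhdsin_sphere eventually_filtermap local_rep_def
    by eventually_elim auto
  then show ?thesis using assms(2) by (simp add: represents_def)
qed

lemma holomorphic_at_iff:
  "holomorphic_at f p \<longleftrightarrow>
     limitin sphere_top f (f p) (nhdsin sphere_top p) \<and> local_rep f p analytic_on {chart p p}"
proof
  assume "holomorphic_at f p"
  then obtain L where L: "represents L f p" by (auto simp: holomorphic_at_def)
  have "local_rep f p analytic_on {chart p p} \<longleftrightarrow> L analytic_on {chart p p}"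
    using represents_eventually_local_rep[OF L] by (intro analytic_at_cong) auto
  then show "limitin sphere_top f (f p) (nhdsin sphere_top p) \<and> local_rep f p analytic_on {chart p p}"
    using L represents_imp_limitin by (auto simp: represents_def)
qed (auto simp: holomorphic_at_def intro: represents_local_rep)

text \<open>For open \<open>S\<close> a neighbourhood within \<open>S\<close> is one in the whole
  space, so continuity can be tested with the filters \<open>nhdsin T p\<close>. This splits
  \<open>holomorphic_map_on\<close> into conditions at single points.\<close>

lemma continuous_map_iff_limitin:
  assumes "openin T S"
  shows "continuous_map (subtopology T S) T' f \<longleftrightarrow> (\<forall>p\<in>S. limitin T' f (f p) (nhdsin T p))"
proof
  assume c: "continuous_map (subtopology T S) T' f"
  have sub: "S \<subseteq> topspace T" using assms openin_subset by blast
  show "\<forall>p\<in>S. limitin T' f (f p) (nhdsin T p)"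
  proof
    fix p assume p: "p \<in> S"
    have "f p \<in> topspace T'" using c p sub by (auto simp: continuous_map_def)
    moreover have "eventually (\<lambda>x. f x \<in> U) (nhdsin T p)" if U: "openin T' U" "f p \<in> U" for U
    proof -
      have "openin (subtopology T S) {x \<in> topspace (subtopology T S). f x \<in> U}"
        using c U(1) by (simp add: continuous_map_def)
      then have "openin T {x \<in> topspace (subtopology T S). f x \<in> U}"
        using assms openin_open_subtopology by blast
      then show ?thesis unfolding eventually_nhdsin using p U sub
        by (intro disjI2 exI[of _ "{x \<in> topspace (subtopology T S). f x \<in> U}"]) auto
    qed
    ultimately show "limitin T' f (f p) (nhdsin T p)" by (simp add: limitin_def)
  qed
next
  assume l: "\<forall>p\<in>S. limitin T' f (f p) (nhdsin T p)"
  have sub: "S \<subseteq> topspace T" using assms openin_subset by blast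
  have "openin T {x \<in> S. f x \<in> U}" if U: "openin T' U" for U
  proof (subst openin_subopen, intro ballI)
    fix p assume p: "p \<in> {x \<in> S. f x \<in> U}"
    then have "eventually (\<lambda>x. f x \<in> U) (nhdsin T p)" using l U by (auto simp: limitin_def)
    then obtain V where "openin T V" "p \<in> V" "\<forall>x\<in>V. f x \<in> U"
      using p sub by (auto simp: eventually_nhdsin)
    then show "\<exists>V. openin T V \<and> p \<in> V \<and> V \<subseteq> {x \<in> S. f x \<in> U}"
      using assms p by (intro exI[of _ "V \<inter> S"]) auto
  qed
  moreover have "S \<inter> topspace T = S" using sub by auto
  ultimately show "continuous_map (subtopology T S) T' f"
    using l assms by (auto simp: continuous_map_def limitin_def openin_open_subtopology Int_absorb1 sub
        Collect_conj_eq Int_commute intro!: funcsetI)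
qed

lemma holomorphic_map_on_iff:
  assumes "openin sphere_top S"
  shows "holomorphic_map_on S f \<longleftrightarrow> (\<forall>p\<in>S. holomorphic_at f p)"
  unfolding holomorphic_map_on_def holomorphic_at_iff continuous_map_iff_limitin[OF assms] by blast

lemma represents_cong:
  assumes "openin sphere_top U" "p \<in> U" "\<And>x. x \<in> U \<Longrightarrow> f x = g x"
  shows "represents L f p \<longleftrightarrow> represents L g p"
proof -
  have ev: "eventually (\<lambda>x. f x = g x) (nhdsin sphere_top p)"
    using assms by (auto simp: eventually_nhdsin)
  have ev: "\<forall>\<^sub>F u in nhds (chart p p). f (unchart p u) = g (unchart p u)"
    using ev by (simp add: nhdsin_sphere eventually_filtermap)
  have "(\<forall>\<^sub>F u in nhds (chart p p). f (unchart p u) = unchart (f p) (L u)) \<longleftrightarrow>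
        (\<forall>\<^sub>F u in nhds (chart p p). g (unchart p u) = unchart (g p) (L u))"
    by (rule eventually_cong[OF ev]) (use assms in simp)
  then show ?thesis by (simp add: represents_def)
qed

lemma holomorphic_at_cong:
  assumes "openin sphere_top U" "p \<in> U" "\<And>x. x \<in> U \<Longrightarrow> f x = g x"
  shows "holomorphic_at f p \<longleftrightarrow> holomorphic_at g p"
  unfolding holomorphic_at_def using represents_cong[of U p f g, OF assms] by blast

text \<open>The target chart of \<open>f\<close> at \<open>p\<close> and the source chart of
  \<open>g\<close> at \<open>f p\<close> are both selected by \<open>f p\<close>, so germs compose
  directly. Continuity of \<open>L\<close> pulls the neighbourhood on which \<open>M\<close>
  describes \<open>g\<close> back to one of \<open>chart p p\<close>.\<close>

lemma represents_compose:
  assumes f: "represents L f p" and g: "represents M g (f p)"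
  shows "represents (M \<circ> L) (g \<circ> f) p"
proof -
  have lim: "filterlim L (nhds (chart (f p) (f p))) (nhds (chart p p))"
    using represents_isCont[OF f] represents_chart[OF f]
    by (metis isCont_def tendsto_nhds_iff)
  have "\<forall>\<^sub>F v in nhds (chart (f p) (f p)). g (unchart (f p) v) = unchart (g (f p)) (M v)"
    using g by (simp add: represents_def)
  then have "\<forall>\<^sub>F u in nhds (chart p p). g (unchart (f p) (L u)) = unchart (g (f p)) (M (L u))"
    using lim by (rule eventually_compose_filterlim)
  moreover have "\<forall>\<^sub>F u in nhds (chart p p). f (unchart p u) = unchart (f p) (L u)"
    using f by (simp add: represents_def)
  ultimately have "\<forall>\<^sub>F u in nhds (chart p p). (g \<circ> f) (unchart p u) = unchart ((g \<circ> f) p) ((M \<circ> L) u)"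
    by eventually_elim simp
  moreover have "(M \<circ> L) analytic_on {chart p p}"
    using f g represents_chart[OF f] by (intro analytic_on_compose) (auto simp: represents_def)
  ultimately show ?thesis by (simp add: represents_def)
qed

lemma holomorphic_at_compose:
  "holomorphic_at f p \<Longrightarrow> holomorphic_at g (f p) \<Longrightarrow> holomorphic_at (g \<circ> f) p"
  unfolding holomorphic_at_def using represents_compose by blast

abbreviation chart_deriv :: "(sphere \<Rightarrow> sphere) \<Rightarrow> sphere \<Rightarrow> complex" where
  "chart_deriv f p \<equiv> deriv (local_rep f p) (chart p p)"

lemma chart_deriv_compose:
  assumes "holomorphic_at f p" "holomorphic_at g (f p)"
  shows "chart_deriv (g \<circ> f) p = chart_deriv g (f p) * chart_deriv f p"
proof -
  obtain L M where L: "represents L f p" and M: "represents M g (f p)"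
    using assms by (auto simp: holomorphic_at_def)
  have "L field_differentiable at (chart p p)" "M field_differentiable at (L (chart p p))"
    using L M represents_chart[OF L]
    by (auto simp: represents_def intro: analytic_on_imp_differentiable_at)
  then have "deriv (M \<circ> L) (chart p p) = deriv M (L (chart p p)) * deriv L (chart p p)"
    by (rule deriv_chain)
  then show ?thesis
    using represents_deriv[OF L] represents_deriv[OF M] represents_chart[OF L]
      represents_deriv[OF represents_compose[OF L M]] by simp
qed

lemma chart_deriv_cong:
  assumes "openin sphere_top U" "p \<in> U" "\<And>x. x \<in> U \<Longrightarrow> f x = g x" "holomorphic_at f p"
  shows "chart_deriv f p = chart_deriv g p"
proof -
  obtain L where L: "represents L f p" using assms(4) by (auto simp: holomorphic_at_def)
  then have "represents L g p" using represents_cong[of U p f g L, OF assms(1-3)] by blast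
  then show ?thesis using L represents_deriv by metis
qed

lemma represents_id: "represents id id p"
  by (simp add: represents_def analytic_on_id)

lemma chart_deriv_id: "chart_deriv id p = 1"
  using represents_deriv[OF represents_id] by (simp add: id_def)

section \<open>Moebius maps and automorphism groups\<close>

text \<open>Homogeneous coordinates [x : y]. The pair (0, 0) names no point and gets a junk value,
  hence the nondegeneracy conditions in the lemmas below.\<close>

definition proj :: "complex \<Rightarrow> complex \<Rightarrow> sphere" where
  "proj x y = (if y = 0 then None else Some (x / y))"

definition mat2 :: "complex \<Rightarrow> complex \<Rightarrow> complex \<Rightarrow> complex \<Rightarrow> complex^2^2" where
  "mat2 a b c d = vector [vector [a, b], vector [c, d]]"

lemma mat2_nth [simp]:
  "mat2 a b c d $ 1 $ 1 = a" "mat2 a b c d $ 1 $ 2 = b"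
  "mat2 a b c d $ 2 $ 1 = c" "mat2 a b c d $ 2 $ 2 = d"
  by (simp_all add: mat2_def)

lemma det_mat2 [simp]: "det (mat2 a b c d) = a * d - b * c"
  by (simp add: det_2)

lemma mat2_eqI:
  fixes A B :: "complex^2^2"
  assumes "A$1$1 = B$1$1" "A$1$2 = B$1$2" "A$2$1 = B$2$1" "A$2$2 = B$2$2"
  shows "A = B"
  using assms by (simp add: vec_eq_iff forall_2)

lemma matrix_mult_nth_2:
  fixes A B :: "complex^2^2"
  shows "(A ** B) $ i $ j = A$i$1 * B$1$j + A$i$2 * B$2$j"
  by (simp add: matrix_matrix_mult_def sum_2)

lemma proj_scale: "k \<noteq> 0 \<Longrightarrow> proj (k * x) (k * y) = proj x y"
  by (simp add: proj_def)

lemma proj_cases: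
  obtains x y where "p = proj x y" "x \<noteq> 0 \<or> y \<noteq> 0"
proof (cases p)
  case None
  then show ?thesis using that[of 1 0] by (simp add: proj_def)
next
  case (Some z)
  then show ?thesis using that[of z 1] by (simp add: proj_def)
qed

lemma moebius_Some: "moebius A (Some z) = proj (A$1$1 * z + A$1$2) (A$2$1 * z + A$2$2)"
  by (simp add: proj_def)

lemma moebius_None: "moebius A None = proj (A$1$1) (A$2$1)"
  by (simp add: proj_def)

declare moebius.simps [simp del]

text \<open>In homogeneous coordinates the map is the linear action of \<open>A\<close>, and the
  separate formulas at infinity and at the pole disappear.\<close>

lemma moebius_proj:
  assumes "x \<noteq> 0 \<or> y \<noteq> 0"
  shows "moebius A (proj x y) = proj (A$1$1 * x + A$1$2 * y) (A$2$1 * x + A$2$2 * y)"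
proof (cases "y = 0")
  case True
  then show ?thesis
    using assms proj_scale[of x "A$1$1" "A$2$1"] by (simp add: proj_def moebius_None mult.commute)
next
  case False
  have "moebius A (proj x y) = moebius A (Some (x / y))"
    using False by (simp add: proj_def)
  also have "\<dots> = proj (y * (A$1$1 * (x / y) + A$1$2)) (y * (A$2$1 * (x / y) + A$2$2))"
    using proj_scale[OF False] by (simp only: moebius_Some)
  also have "y * (A$1$1 * (x / y) + A$1$2) = A$1$1 * x + A$1$2 * y"
    using False by (simp add: field_simps)
  also have "y * (A$2$1 * (x / y) + A$2$2) = A$2$1 * x + A$2$2 * y"
    using False by (simp add: field_simps)
  finally show ?thesis .
qed

lemma linear_nondegenerate:
  fixes A :: "complex^2^2"
  assumes "det A \<noteq> 0" "x \<noteq> 0 \<or> y \<noteq> 0"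
  shows "A$1$1 * x + A$1$2 * y \<noteq> 0 \<or> A$2$1 * x + A$2$2 * y \<noteq> 0"
proof (rule ccontr)
  assume "\<not> ?thesis"
  then have e: "A$1$1 * x + A$1$2 * y = 0" "A$2$1 * x + A$2$2 * y = 0" by auto
  \<comment> \<open>Cramer's rule: the adjugate recovers \<open>det A\<close> times the vector from
    its image.\<close>
  have "det A * x = A$2$2 * (A$1$1 * x + A$1$2 * y) - A$1$2 * (A$2$1 * x + A$2$2 * y)"
    "det A * y = A$1$1 * (A$2$1 * x + A$2$2 * y) - A$2$1 * (A$1$1 * x + A$1$2 * y)"
    by (simp_all add: det_2 algebra_simps)
  then show False using e assms by auto
qed

lemma moebius_mult:
  assumes "det B \<noteq> 0"
  shows "moebius (A ** B) p = moebius A (moebius B p)"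
proof -
  obtain x y where p: "p = proj x y" and xy: "x \<noteq> 0 \<or> y \<noteq> 0" by (rule proj_cases)
  show ?thesis unfolding p moebius_proj[OF xy] moebius_proj[OF linear_nondegenerate[OF assms xy]]
    by (simp add: matrix_mult_nth_2 algebra_simps)
qed

lemma moebius_scalar:
  assumes "k \<noteq> 0"
  shows "moebius (mat2 k 0 0 k) p = p"
proof -
  obtain x y where p: "p = proj x y" and xy: "x \<noteq> 0 \<or> y \<noteq> 0" by (rule proj_cases)
  show ?thesis unfolding p moebius_proj[OF xy] by (simp add: proj_scale assms)
qed

lemma mat_1_eq_mat2: "(mat 1 :: complex^2^2) = mat2 1 0 0 1"
  by (rule mat2_eqI) (simp_all add: mat_def)

lemma moebius_mat_1 [simp]: "moebius (mat 1) = id"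
  by (rule ext) (simp add: mat_1_eq_mat2 moebius_scalar)

text \<open>The adjugate. It inverts \<open>A\<close> up to a scalar matrix, which acts trivially on
  the sphere, so inverse maps are obtained without division and with the same determinant.\<close>

definition adj :: "complex^2^2 \<Rightarrow> complex^2^2" where
  "adj A = mat2 (A$2$2) (- A$1$2) (- A$2$1) (A$1$1)"

lemma det_adj [simp]: "det (adj A) = det A"
  by (simp add: adj_def det_2)

lemma adj_mult: "adj A ** A = mat2 (det A) 0 0 (det A)" "A ** adj A = mat2 (det A) 0 0 (det A)"
  by (rule mat2_eqI; simp add: adj_def matrix_mult_nth_2 det_2)+

lemma moebius_adj [simp]:
  assumes "det A \<noteq> 0"
  shows "moebius (adj A) (moebius A p) = p" "moebius A (moebius (adj A) p) = p"
  using assms by (simp_all flip: moebius_mult add: adj_mult moebius_scalar)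

lemma moebius_normalize:
  assumes "det A \<noteq> 0"
  obtains B where "det B = 1" "moebius B = moebius A"
proof
  \<comment> \<open>Scaling all entries by \<open>k\<close> multiplies the determinant by the square
    of \<open>k\<close> and leaves the map alone.\<close>
  define k where "k = inverse (csqrt (det A))"
  have k: "k \<noteq> 0" "k\<^sup>2 * det A = 1" using assms by (simp_all add: k_def power_inverse)
  define B where "B = mat2 (k * A$1$1) (k * A$1$2) (k * A$2$1) (k * A$2$2)"
  show "det B = 1" using k(2) by (simp add: B_def det_2 power2_eq_square algebra_simps)
  show "moebius B = moebius A"
  proof
    fix p
    obtain x y where p: "p = proj x y" and xy: "x \<noteq> 0 \<or> y \<noteq> 0" by (rule proj_cases)
    show "moebius B p = moebius A p"
      unfolding p moebius_proj[OF xy] B_def mat2_nth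
      using proj_scale[OF k(1), of "A$1$1 * x + A$1$2 * y" "A$2$1 * x + A$2$2 * y"]
      by (simp add: algebra_simps)
  qed
qed

text \<open>The finite fixed points are roots of \<open>c z^2 + e z - b\<close>, and infinity is
  fixed only if \<open>c = 0\<close>. Three fixed points counted in this way force all coefficients
  to vanish, which leaves a scalar matrix.\<close>

lemma moebius_fixed_points:
  fixes A :: "complex^2^2"
  assumes d: "det A \<noteq> 0" and dist: "p \<noteq> q" "q \<noteq> r" "p \<noteq> r"
    and fix3: "moebius A p = p" "moebius A q = q" "moebius A r = r"
  shows "A$1$2 = 0 \<and> A$2$1 = 0 \<and> A$2$2 = A$1$1"
proof -
  let ?c = "A$2$1" and ?e = "A$2$2 - A$1$1" and ?b = "A$1$2"
  have fin: "?c * z\<^sup>2 + ?e * z - ?b = 0" if "moebius A (Some z) = Some z" for z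
    using that by (auto simp: moebius_Some proj_def field_simps power2_eq_square split: if_splits)
  have inf: "?c = 0" if "moebius A None = None"
    using that by (auto simp: moebius_None proj_def split: if_splits)
  have two: "?c * (x + y) + ?e = 0"
    if "moebius A (Some x) = Some x" "moebius A (Some y) = Some y" "x \<noteq> y" for x y
  proof -
    have "(x - y) * (?c * (x + y) + ?e) = 0"
      using fin[OF that(1)] fin[OF that(2)] by (simp add: algebra_simps power2_eq_square)
    then show ?thesis using that(3) by simp
  qed
  \<comment> \<open>For triples containing infinity; the points being distinct, the other two are
    finite.\<close>
  have ce: "?c = 0" "?e = 0" if "moebius A None = None" 
    "moebius A (Some x) = Some x" "moebius A (Some y) = Some y" "x \<noteq> y" for x y
    using inf[OF that(1)] two[OF that(2-4)] by auto
  have "?c = 0 \<and> ?e = 0"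
  proof (cases p; cases q; cases r)
    fix x y z assume *: "p = Some x" "q = Some y" "r = Some z"
    have 1: "?c * (x + y) + ?e = 0" using two[of x y] * fix3 dist by simp
    have 2: "?c * (x + z) + ?e = 0" using two[of x z] * fix3 dist by simp
    have "?c * (y - z) = (?c * (x + y) + ?e) - (?c * (x + z) + ?e)" by (simp add: algebra_simps)
    then have "?c * (y - z) = 0" unfolding 1 2 by simp
    then have "?c = 0" using * dist by auto
    then show ?thesis using 1 by simp
  qed (use ce fix3 dist in auto)
  moreover obtain z where "moebius A (Some z) = Some z"
    using fix3 dist by (metis option.exhaust)
  ultimately show ?thesis using fin[of z] by auto
qed

lemma moebius_eqI:
  assumes "det A \<noteq> 0" "det B \<noteq> 0" "p \<noteq> q" "q \<noteq> r" "p \<noteq> r"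
    and "moebius A p = moebius B p" "moebius A q = moebius B q" "moebius A r = moebius B r"
  shows "moebius A = moebius B"
proof
  fix x
  define C where "C = adj B ** A"
  have C: "det C \<noteq> 0" using assms by (simp add: C_def det_mul)
  have fixed: "moebius C y = y" if "moebius A y = moebius B y" for y
    using that assms by (simp add: C_def moebius_mult)
  have "C$1$2 = 0 \<and> C$2$1 = 0 \<and> C$2$2 = C$1$1"
    using moebius_fixed_points[OF C assms(3-5)] fixed assms by blast
  then have "C = mat2 (C$1$1) 0 0 (C$1$1)" by (intro mat2_eqI) simp_all
  moreover from this have "C$1$1 \<noteq> 0" using C by (metis det_mat2 mult_zero_left diff_zero)
  ultimately have "moebius C x = x" using moebius_scalar by metis
  then have "moebius B (moebius (adj B) (moebius A x)) = moebius B x"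
    using assms by (simp add: C_def moebius_mult)
  then show "moebius A x = moebius B x" using assms by simp
qed

lemma eventually_nhds_nonzero:
  fixes D :: "complex \<Rightarrow> complex"
  assumes "isCont D c" "D c \<noteq> 0"
  shows "\<forall>\<^sub>F u in nhds c. D u \<noteq> 0"
proof -
  have "filterlim D (nhds (D c)) (nhds c)"
    using assms(1) by (simp add: isCont_def tendsto_nhds_iff)
  with t1_space_nhds[OF assms(2)] show ?thesis by (rule eventually_compose_filterlim)
qed

text \<open>If \<open>D\<close> is nonzero at the centre, \<open>N / D\<close> is analytic there and
  expresses \<open>f\<close> in the finite chart. Otherwise \<open>N\<close> is nonzero there and
  \<open>D / N\<close> is the expression in the chart at infinity.\<close>

lemma holomorphic_at_proj:
  assumes "\<And>u. f (unchart p u) = proj (N u) (D u)"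
    and "N holomorphic_on UNIV" "D holomorphic_on UNIV"
    and "N (chart p p) \<noteq> 0 \<or> D (chart p p) \<noteq> 0"
  shows "holomorphic_at f p"
proof -
  let ?c = "chart p p"
  have an: "N analytic_on {?c}" "D analytic_on {?c}"
    using assms(2,3) analytic_on_open[of UNIV] analytic_on_subset by blast+
  have co: "isCont N ?c" "isCont D ?c"
    using an by (metis analytic_on_imp_differentiable_at field_differentiable_imp_continuous_at singletonI)+
  have fp: "f p = proj (N ?c) (D ?c)" by (metis assms(1) unchart_chart)
  show ?thesis
  proof (cases "D ?c = 0")
    case False
    have "\<forall>\<^sub>F u in nhds ?c. D u \<noteq> 0"
      using co(2) False by (rule eventually_nhds_nonzero)
    then have "\<forall>\<^sub>F u in nhds ?c. f (unchart p u) = unchart (f p) (N u / D u)"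
      by eventually_elim (use False fp in \<open>simp add: assms(1) proj_def\<close>)
    moreover have "(\<lambda>u. N u / D u) analytic_on {?c}"
      using an False by (intro analytic_intros) auto
    ultimately show ?thesis by (auto simp: holomorphic_at_def represents_def)
  next
    case True
    then have N: "N ?c \<noteq> 0" using assms(4) by simp
    have "\<forall>\<^sub>F u in nhds ?c. N u \<noteq> 0"
      using co(1) N by (rule eventually_nhds_nonzero)
    then have "\<forall>\<^sub>F u in nhds ?c. f (unchart p u) = unchart (f p) (D u / N u)"
      by eventually_elim (use True fp in \<open>simp add: assms(1) proj_def\<close>)
    moreover have "(\<lambda>u. D u / N u) analytic_on {?c}"
      using an N by (intro analytic_intros) auto
    ultimately show ?thesis by (auto simp: holomorphic_at_def represents_def)
  qed
qed

lemma holomorphic_at_moebius: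
  assumes "det A \<noteq> 0"
  shows "holomorphic_at (moebius A) p"
proof (cases p)
  case None
  \<comment> \<open>The coordinate around infinity is the reciprocal, so \<open>u\<close> stands for
    the point [1 : u]; around a finite point it stands for [u : 1].\<close>
  have u: "unchart p u = proj 1 u" for u using None by (simp add: proj_def field_simps)
  show ?thesis
  proof (rule holomorphic_at_proj)
    show "moebius A (unchart p u) = proj (A$1$1 * 1 + A$1$2 * u) (A$2$1 * 1 + A$2$2 * u)" for u
      unfolding u by (rule moebius_proj) simp
    show "A$1$1 * 1 + A$1$2 * chart p p \<noteq> 0 \<or> A$2$1 * 1 + A$2$2 * chart p p \<noteq> 0"
      using assms by (rule linear_nondegenerate) simp
  qed (intro holomorphic_intros)+
next
  case (Some a)
  have u: "unchart p u = proj u 1" for u using Some by (simp add: proj_def)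
  show ?thesis
  proof (rule holomorphic_at_proj)
    show "moebius A (unchart p u) = proj (A$1$1 * u + A$1$2 * 1) (A$2$1 * u + A$2$2 * 1)" for u
      unfolding u by (rule moebius_proj) simp
    show "A$1$1 * chart p p + A$1$2 * 1 \<noteq> 0 \<or> A$2$1 * chart p p + A$2$2 * 1 \<noteq> 0"
      using assms by (rule linear_nondegenerate) simp
  qed (intro holomorphic_intros)+
qed

lemma openin_sphere_UNIV: "openin sphere_top UNIV"
  using openin_topspace[of sphere_top] by simp

lemma openin_model_surface: "S \<in> model_surfaces \<Longrightarrow> openin sphere_top S"
  unfolding model_surfaces_def by (auto simp: openin_sphere_UNIV)

text \<open>Any holomorphic two-sided inverse on \<open>S\<close> may replace
  \<open>inv_into S g\<close>: the two agree on \<open>S\<close>, and holomorphy on an open set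
  depends on the values there only.\<close>

lemma Aut_iff:
  assumes S: "openin sphere_top S"
  shows "g \<in> Aut S \<longleftrightarrow> g \<in> extensional S \<and>
     (\<exists>h. \<forall>x\<in>S. g x \<in> S \<and> h x \<in> S \<and> h (g x) = x \<and> g (h x) = x \<and>
              holomorphic_at g x \<and> holomorphic_at h x)"
proof
  assume "g \<in> Aut S"
  then have b: "bij_betw g S S" and e: "g \<in> extensional S"
    and h: "\<forall>x\<in>S. holomorphic_at g x" "\<forall>x\<in>S. holomorphic_at (inv_into S g) x"
    by (auto simp: Aut_def Bij_def holomorphic_map_on_iff[OF S])
  have "\<forall>x\<in>S. g x \<in> S \<and> inv_into S g x \<in> S \<and> inv_into S g (g x) = x \<and> g (inv_into S g x) = x \<and>
              holomorphic_at g x \<and> holomorphic_at (inv_into S g) x"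
    using b h by (auto simp: bij_betw_def inv_into_f_f f_inv_into_f inv_into_into)
  then show "g \<in> extensional S \<and> (\<exists>h. \<forall>x\<in>S. g x \<in> S \<and> h x \<in> S \<and> h (g x) = x \<and> g (h x) = x \<and>
              holomorphic_at g x \<and> holomorphic_at h x)" using e by blast
next
  assume "g \<in> extensional S \<and> (\<exists>h. \<forall>x\<in>S. g x \<in> S \<and> h x \<in> S \<and> h (g x) = x \<and> g (h x) = x \<and>
              holomorphic_at g x \<and> holomorphic_at h x)"
  then obtain h where e: "g \<in> extensional S" and gh: "\<And>x. x \<in> S \<Longrightarrow> g x \<in> S"
      "\<And>x. x \<in> S \<Longrightarrow> h x \<in> S" "\<And>x. x \<in> S \<Longrightarrow> h (g x) = x" "\<And>x. x \<in> S \<Longrightarrow> g (h x) = x"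
      "\<And>x. x \<in> S \<Longrightarrow> holomorphic_at g x" "\<And>x. x \<in> S \<Longrightarrow> holomorphic_at h x" by blast
  have b: "bij_betw g S S"
    by (rule bij_betw_byWitness[of _ h]) (use gh in auto)
  have "inv_into S g x = h x" if "x \<in> S" for x
    by (rule inv_into_f_eq) (use b gh that in \<open>auto simp: bij_betw_def\<close>)
  then have "holomorphic_at (inv_into S g) x" if "x \<in> S" for x
    using holomorphic_at_cong[of S x "inv_into S g" h, OF S that] gh(6)[OF that] by blast
  then show "g \<in> Aut S" using b e gh(5) by (simp add: Aut_def Bij_def holomorphic_map_on_iff[OF S])
qed

lemma Aut_inverse:
  assumes "openin sphere_top S" "g \<in> Aut S"
  obtains h where "h \<in> Aut S"
    "\<forall>x\<in>S. g x \<in> S \<and> h x \<in> S \<and> h (g x) = x \<and> g (h x) = x \<and>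
            holomorphic_at g x \<and> holomorphic_at h x"
proof -
  obtain h where h: "\<forall>x\<in>S. g x \<in> S \<and> h x \<in> S \<and> h (g x) = x \<and> g (h x) = x \<and>
              holomorphic_at g x \<and> holomorphic_at h x"
    using assms Aut_iff by blast
  have hol: "holomorphic_at (restrict h S) x" if "x \<in> S" for x
    using h that holomorphic_at_cong[of S x "restrict h S" h] assms(1) by auto
  have "restrict h S \<in> Aut S"
    unfolding Aut_iff[OF assms(1)] using h hol by (intro conjI exI[of _ g]) auto
  then show ?thesis using h hol by (intro that[of "restrict h S"]) auto
qed

lemma moebius_in_Aut:
  assumes S: "openin sphere_top S" and d: "det A \<noteq> 0" and im: "moebius A ` S = S"
  shows "restrict (moebius A) S \<in> Aut S"
proof -
  have "moebius (adj A) x \<in> S" if "x \<in> S" for x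
    using that im d by (metis imageE moebius_adj(1))
  moreover have "holomorphic_at (restrict (moebius A) S) x" if "x \<in> S" for x
    using holomorphic_at_cong[of S x "restrict (moebius A) S" "moebius A"] S that
      holomorphic_at_moebius[OF d] by auto
  moreover have "holomorphic_at (moebius (adj A)) x" for x
    using holomorphic_at_moebius d by simp
  ultimately show ?thesis unfolding Aut_iff[OF S]
    using d im by (intro conjI exI[of _ "moebius (adj A)"]) auto
qed

lemma moebius_in_Aut_UNIV:
  assumes "det A \<noteq> 0"
  shows "moebius A \<in> Aut UNIV"
  using moebius_in_Aut[OF openin_sphere_UNIV assms] surjI[of "moebius A" "moebius (adj A)"] assms
  by (simp add: restrict_UNIV)

lemma compose_in_Aut:
  assumes S: "openin sphere_top S" and "g \<in> Aut S" "h \<in> Aut S"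
  shows "compose S g h \<in> Aut S"
proof -
  obtain g' where g: "\<forall>x\<in>S. g x \<in> S \<and> g' x \<in> S \<and> g' (g x) = x \<and> g (g' x) = x \<and>
      holomorphic_at g x \<and> holomorphic_at g' x"
    using Aut_inverse[OF S assms(2)] by blast
  obtain h' where h: "\<forall>x\<in>S. h x \<in> S \<and> h' x \<in> S \<and> h' (h x) = x \<and> h (h' x) = x \<and>
      holomorphic_at h x \<and> holomorphic_at h' x"
    using Aut_inverse[OF S assms(3)] by blast
  have "holomorphic_at (compose S g h) x" if "x \<in> S" for x
    using holomorphic_at_cong[of S x "compose S g h" "g \<circ> h"] S that g h holomorphic_at_compose[of h x g]
    by (auto simp: compose_def)
  moreover have "holomorphic_at (h' \<circ> g') x" if "x \<in> S" for x
    using that g h by (intro holomorphic_at_compose) auto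
  ultimately show ?thesis unfolding Aut_iff[OF S]
    using g h by (intro conjI exI[of _ "h' \<circ> g'"]) (auto simp: compose_def)
qed

lemma group_AutGroup:
  assumes S: "openin sphere_top S"
  shows "subgroup (Aut S) (BijGroup S)" "Group.group (AutGroup S)"
proof -
  have sub: "Aut S \<subseteq> Bij S" by (auto simp: Aut_def)
  show *: "subgroup (Aut S) (BijGroup S)"
  proof (rule subgroup.intro)
    show "Aut S \<subseteq> carrier (BijGroup S)" using sub by (simp add: BijGroup_def)
    show "x \<otimes>\<^bsub>BijGroup S\<^esub> y \<in> Aut S" if "x \<in> Aut S" "y \<in> Aut S" for x y
      using that sub compose_in_Aut[OF S that] by (auto simp: BijGroup_def)
    have hol: "holomorphic_at (\<lambda>x\<in>S. x) x" if "x \<in> S" for x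
      using holomorphic_at_cong[of S x "\<lambda>x\<in>S. x" id] S that represents_id
      by (auto simp: holomorphic_at_def)
    show "\<one>\<^bsub>BijGroup S\<^esub> \<in> Aut S"
      unfolding Aut_iff[OF S] BijGroup_def
      using hol by (auto intro!: exI[of _ "\<lambda>x\<in>S. x"])
    show "inv\<^bsub>BijGroup S\<^esub> x \<in> Aut S" if x: "x \<in> Aut S" for x
    proof -
      obtain h where h: "h \<in> Aut S" "\<forall>y\<in>S. x y \<in> S \<and> h y \<in> S \<and> h (x y) = y \<and> x (h y) = y"
        using Aut_inverse[OF S x] by (metis (lifting))
      have "inv\<^bsub>BijGroup S\<^esub> x = (\<lambda>y\<in>S. inv_into S x y)" using x sub by (intro inv_BijGroup) auto
      also have "\<dots> = h"
      proof (rule extensionalityI[of _ S])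
        show "h \<in> extensional S" using h(1) by (simp add: Aut_def Bij_def)
        fix y assume "y \<in> S"
        then show "(\<lambda>y\<in>S. inv_into S x y) y = h y"
          using h x by (auto intro!: inv_into_f_eq simp: Aut_def Bij_def bij_betw_def)
      qed simp
      finally show ?thesis using h by simp
    qed
  qed
  show "Group.group (AutGroup S)"
    unfolding AutGroup_def using subgroup.subgroup_is_group[OF * group_BijGroup] .
qed

section \<open>Automorphisms of the model surfaces\<close>

lemma holomorphic_on_finite_part:
  assumes "open T" "\<And>z. z \<in> T \<Longrightarrow> holomorphic_at f (Some z)" "\<And>z. z \<in> T \<Longrightarrow> f (Some z) = Some (F z)"
  shows "F holomorphic_on T"
proof -
  have "F analytic_on {z}" if z: "z \<in> T" for z
  proof -
    have "local_rep f (Some z) analytic_on {z}"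
      using assms(2)[OF z] by (simp add: holomorphic_at_iff)
    moreover have "\<forall>\<^sub>F u in nhds z. local_rep f (Some z) u = F u"
      using eventually_nhds_in_open[OF assms(1) z]
      by eventually_elim (use assms(3) z in \<open>simp add: local_rep_def\<close>)
    ultimately show ?thesis using analytic_at_cong by blast
  qed
  then show ?thesis using analytic_imp_holomorphic analytic_on_analytic_at by blast
qed

text \<open>The inverse \<open>F'\<close> is bounded on disks, so \<open>F\<close> tends to infinity
  at infinity and is a polynomial. Injectivity keeps its derivative free of zeros, hence constant by
  the fundamental theorem of algebra.\<close>

lemma plane_automorphism:
  assumes hol: "F holomorphic_on UNIV" "F' holomorphic_on UNIV"
    and inv: "\<And>z. F' (F z) = z" "\<And>z. F (F' z) = z"
  obtains a b where "a \<noteq> 0" "\<And>z. F z = a * z + b"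
proof -
  have "filterlim F at_infinity at_infinity"
    unfolding filterlim_at_infinity[OF order_refl]
  proof (intro allI impI)
    fix r :: real
    have "bounded (F' ` cball 0 r)"
      using hol(2) by (intro compact_imp_bounded compact_continuous_image)
        (auto intro: continuous_on_subset holomorphic_on_imp_continuous_on)
    then obtain B where B: "\<And>z. z \<in> F' ` cball 0 r \<Longrightarrow> norm z \<le> B" by (auto simp: bounded_iff)
    have "r \<le> norm (F z)" if "norm z \<ge> B + 1" for z
    proof (rule ccontr)
      assume "\<not> r \<le> norm (F z)"
      then have "F' (F z) \<in> F' ` cball 0 r" by auto
      then show False using B inv that by fastforce
    qed
    then show "\<forall>\<^sub>F z in at_infinity. r \<le> norm (F z)"
      by (auto simp: eventually_at_infinity)
  qed
  then have "((inverse \<circ> F) \<longlongrightarrow> 0) at_infinity"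
    unfolding comp_def by (rule filterlim_compose[OF tendsto_inverse_0])
  then obtain c n where c: "\<And>z. F z = (\<Sum>i\<le>n. c i * z ^ i)"
    using pole_at_infinity[OF hol(1)] by metis
  define p where "p = (\<Sum>i\<le>n. Polynomial.monom (c i) i)"
  have p: "F = poly p"
    by (rule ext) (simp add: p_def c poly_sum Polynomial.poly_monom)
  have "\<not> (\<exists>z. poly (pderiv p) z = 0)"
  proof
    assume "\<exists>z. poly (pderiv p) z = 0"
    then obtain z where z: "poly (pderiv p) z = 0" ..
    have "inj_on F UNIV" by (rule inj_on_inverseI[of _ F']) (rule inv(1))
    then have "deriv F z \<noteq> 0"
      using holomorphic_injective_imp_regular[OF hol(1), of z] by auto
    then show False using DERIV_imp_deriv[OF poly_DERIV[of p z]] z p by simp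
  qed
  then have "Polynomial.degree (pderiv p) = 0" using alg_closed_imp_poly_has_root[of "pderiv p"] by auto
  then have deg: "Polynomial.degree p \<le> 1" by (simp add: degree_pderiv)
  have peq: "p = [:Polynomial.coeff p 0, Polynomial.coeff p 1:]"
    by (rule Polynomial.poly_eqI)
      (use deg in \<open>auto simp: Polynomial.coeff_pCons Polynomial.coeff_eq_0 split: nat.splits\<close>)
  then have F: "F z = Polynomial.coeff p 1 * z + Polynomial.coeff p 0" for z
  proof -
    have "F z = poly [:Polynomial.coeff p 0, Polynomial.coeff p 1:] z"
      unfolding p by (rule arg_cong[OF peq, of "\<lambda>q. poly q z"])
    then show ?thesis by (simp add: mult.commute add.commute)
  qed
  moreover have "Polynomial.coeff p 1 \<noteq> 0"
  proof
    assume "Polynomial.coeff p 1 = 0"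
    then have "F 0 = F 1" by (simp add: F)
    then show False using inv(1) by (metis zero_neq_one)
  qed
  ultimately show ?thesis using that by blast
qed

text \<open>After composition with the disk automorphism that sends \<open>G 0\<close> to 0, the
  Schwarz lemma applies to the map and to its inverse. Their derivatives at 0 have product 1 and
  modulus at most 1 each, so the equality case makes \<open>F\<close> a rotation.\<close>

lemma disk_automorphism:
  assumes hol: "G holomorphic_on ball 0 1" "G' holomorphic_on ball 0 1"
    and maps: "\<And>z. norm z < 1 \<Longrightarrow> norm (G z) < 1" "\<And>z. norm z < 1 \<Longrightarrow> norm (G' z) < 1"
    and inv: "\<And>z. norm z < 1 \<Longrightarrow> G' (G z) = z" "\<And>z. norm z < 1 \<Longrightarrow> G (G' z) = z"
  obtains \<alpha> a where "norm \<alpha> = 1" "norm a < 1"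
    "\<And>z. norm z < 1 \<Longrightarrow> G z = (\<alpha> * z + a) / (1 + cnj a * \<alpha> * z)"
proof -
  define a where "a = G 0"
  have a: "norm a < 1" using maps(1)[of 0] by (simp add: a_def)
  define F where "F = Moebius_function 0 a \<circ> G"
  define F' where "F' = G' \<circ> Moebius_function 0 (- a)"
  have sub: "G ` ball 0 1 \<subseteq> ball 0 1" "Moebius_function 0 (-a) ` ball 0 1 \<subseteq> ball 0 1"
    using maps(1) Moebius_function_norm_lt_1[of "-a"] a by auto
  have holF: "F holomorphic_on ball 0 1"
    unfolding F_def using hol(1) Moebius_function_holomorphic[OF a] sub(1)
    by (rule holomorphic_on_compose_gen)
  have holF': "F' holomorphic_on ball 0 1"
    unfolding F'_def using Moebius_function_holomorphic[of "-a"] a hol(2) sub(2)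
    by (intro holomorphic_on_compose_gen) auto
  have F0: "F 0 = 0" by (simp add: F_def a_def Moebius_function_eq_zero)
  have F'0: "F' 0 = 0" using inv(1)[of 0] by (simp add: F'_def Moebius_function_of_zero a_def)
  have nF: "norm (F z) < 1" if "norm z < 1" for z
    using that maps(1) a by (simp add: F_def Moebius_function_norm_lt_1)
  have nF': "norm (F' z) < 1" if "norm z < 1" for z
    using that maps(2) a by (simp add: F'_def Moebius_function_norm_lt_1)
  have FG: "Moebius_function 0 (-a) (F z) = G z" if "norm z < 1" for z
    using that maps(1) a by (simp add: F_def Moebius_function_compose)
  have F'F: "F' (F z) = z" if "norm z < 1" for z
    using FG[OF that] inv(1)[OF that] by (simp add: F'_def)
  have "F field_differentiable at 0" "F' field_differentiable at (F 0)"
    using holF holF' F0 by (auto intro: holomorphic_on_imp_differentiable_at[of _ "ball 0 1"])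
  then have "deriv (F' \<circ> F) 0 = deriv F' (F 0) * deriv F 0"
    by (rule deriv_chain)
  moreover have "deriv (F' \<circ> F) 0 = deriv id (0::complex)"
  proof (rule deriv_cong_ev)
    show "\<forall>\<^sub>F z in nhds 0. (F' \<circ> F) z = id z"
      using eventually_nhds_in_open[of "ball 0 1" "0::complex"]
      by (auto elim!: eventually_mono simp: F'F)
  qed simp
  ultimately have prod: "norm (deriv F' 0) * norm (deriv F 0) = 1"
    by (simp add: F0 flip: norm_mult)
  have le: "norm (deriv F 0) \<le> 1" "norm (deriv F' 0) \<le> 1"
    using Schwarz_Lemma(2)[OF holF F0 nF, of 0] Schwarz_Lemma(2)[OF holF' F'0 nF', of 0] by auto
  have "norm (deriv F 0) = 1"
    using prod le mult_right_mono[OF le(2), of "norm (deriv F 0)"] by auto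
  then obtain \<alpha> where \<alpha>: "\<And>z. norm z < 1 \<Longrightarrow> F z = \<alpha> * z" "norm \<alpha> = 1"
    using Schwarz_Lemma(3)[OF holF F0 nF, of 0] by auto
  have "G z = (\<alpha> * z + a) / (1 + cnj a * \<alpha> * z)" if z: "norm z < 1" for z
    using FG[OF z] \<alpha>(1)[OF z] by (simp add: Moebius_function_simple mult.assoc)
  then show ?thesis using that \<alpha>(2) a by blast
qed

lemma finite_AutE:
  assumes S: "openin sphere_top (Some ` T)" and T: "open T" and g: "g \<in> Aut (Some ` T)"
  obtains F F' where "F holomorphic_on T" "F' holomorphic_on T"
    "\<forall>z\<in>T. g (Some z) = Some (F z) \<and> F z \<in> T \<and> F' z \<in> T \<and> F' (F z) = z \<and> F (F' z) = z"
proof -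
  obtain h where h: "\<forall>x\<in>Some ` T. g x \<in> Some ` T \<and> h x \<in> Some ` T \<and> h (g x) = x \<and> g (h x) = x \<and>
            holomorphic_at g x \<and> holomorphic_at h x"
    by (rule Aut_inverse[OF S g], erule that)
  define F where "F z = the (g (Some z))" for z
  define F' where "F' z = the (h (Some z))" for z
  have F: "g (Some z) = Some (F z)" "F z \<in> T" "h (Some z) = Some (F' z)" "F' z \<in> T" if "z \<in> T" for z
  proof -
    have "g (Some z) \<in> Some ` T" "h (Some z) \<in> Some ` T" using h that by blast+
    then show "g (Some z) = Some (F z)" "F z \<in> T" "h (Some z) = Some (F' z)" "F' z \<in> T"
      by (auto simp: F_def F'_def)
  qed
  have "F' (F z) = z \<and> F (F' z) = z" if z: "z \<in> T" for z
    using bspec[OF h, of "Some z"] z F(1)[OF z] F(3)[OF z] F(1)[OF F(4)[OF z]] F(3)[OF F(2)[OF z]] by simp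
  moreover have "F holomorphic_on T"
    by (rule holomorphic_on_finite_part[OF T, of g]) (use h F(1) in blast)+
  moreover have "F' holomorphic_on T"
    by (rule holomorphic_on_finite_part[OF T, of h]) (use h F(3) in blast)+
  ultimately show ?thesis using F(1,2,4) by (intro that[of F F']) auto
qed

lemma affine_moebius:
  assumes "\<And>z. f (Some z) = Some (a * z + b)"
  shows "f (Some z) = moebius (mat2 a b 0 1) (Some z)"
  using assms by (simp add: moebius_Some proj_def)

text \<open>Composing with a Moebius map that takes the image of infinity back to infinity leaves an
  automorphism of the plane, which is affine.\<close>

lemma Aut_UNIV_moebius:
  assumes g: "g \<in> Aut UNIV"
  obtains A where "det A \<noteq> 0" "g = moebius A"
proof -
  obtain B where B: "det B \<noteq> 0" "moebius B (g None) = None"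
  proof (cases "g None")
    case None
    then show ?thesis using that[of "mat 1"] by (simp add: det_I)
  next
    case (Some a)
    \<comment> \<open>The map z -> 1 / (z - a).\<close>
    then show ?thesis using that[of "mat2 0 1 1 (-a)"] by (simp add: moebius_Some proj_def)
  qed
  define f where "f = moebius B \<circ> g"
  obtain h where h: "\<forall>x\<in>UNIV. g x \<in> UNIV \<and> h x \<in> UNIV \<and> h (g x) = x \<and> g (h x) = x \<and>
            holomorphic_at g x \<and> holomorphic_at h x"
    by (rule Aut_inverse[OF openin_sphere_UNIV g], erule that)
  define f' where "f' = h \<circ> moebius (adj B)"
  have inv: "f' (f x) = x" "f (f' x) = x" for x
    using h B by (simp_all add: f_def f'_def)
  have hol: "holomorphic_at f x" "holomorphic_at f' x" for x
    unfolding f_def f'_def using h B by (auto intro!: holomorphic_at_compose holomorphic_at_moebius)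
  have f_None: "f None = None" using B by (simp add: f_def)
  then have f'_None: "f' None = None" by (metis inv(1))
  define F where "F z = the (f (Some z))" for z
  define F' where "F' z = the (f' (Some z))" for z
  have F: "f (Some z) = Some (F z)" for z
    using inv(1)[of "Some z"] f'_None by (cases "f (Some z)") (auto simp: F_def)
  have F': "f' (Some z) = Some (F' z)" for z
    using inv(2)[of "Some z"] f_None by (cases "f' (Some z)") (auto simp: F'_def)
  have "F' (F z) = z" "F (F' z) = z" for z
    using inv[of "Some z"] F F' by simp_all
  moreover have "F holomorphic_on UNIV" "F' holomorphic_on UNIV"
    using holomorphic_on_finite_part[of UNIV f F] holomorphic_on_finite_part[of UNIV f' F'] hol F F'
    by auto
  ultimately obtain a b where ab: "a \<noteq> 0" "\<And>z. F z = a * z + b"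
    using plane_automorphism by metis
  define C where "C = mat2 a b 0 1"
  have "f x = moebius C x" for x
    using affine_moebius[of f a b] ab(2) f_None F unfolding C_def
    by (cases x) (simp_all add: moebius_None proj_def)
  moreover have "g x = moebius (adj B) (f x)" for x using B by (simp add: f_def)
  moreover have C: "det C \<noteq> 0" using ab by (simp add: C_def)
  ultimately have "g x = moebius (adj B ** C) x" for x by (simp add: moebius_mult)
  moreover have "det (adj B ** C) \<noteq> 0" using B C by (simp add: det_mul)
  ultimately show ?thesis using that[of "adj B ** C"] by blast
qed

lemma Aut_moebius:
  assumes S: "S \<in> model_surfaces" and g: "g \<in> Aut S"
  obtains A where "det A = 1" "g = restrict (moebius A) S" "moebius A ` S = S"
proof -
  have o: "openin sphere_top S" using S by (rule openin_model_surface)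
  have "\<exists>A. det A \<noteq> 0 \<and> (\<forall>x\<in>S. g x = moebius A x)"
  proof -
    consider "S = UNIV" | "S = range Some" | "S = Some ` ball 0 1"
      using S by (auto simp: model_surfaces_def)
    then show ?thesis
    proof cases
      case 1
      then show ?thesis using g Aut_UNIV_moebius by metis
    next
      case 2
      have "open (UNIV :: complex set)" by simp
      then obtain F F' where F: "F holomorphic_on UNIV" "F' holomorphic_on UNIV"
        "\<forall>z\<in>UNIV. g (Some z) = Some (F z) \<and> F z \<in> UNIV \<and> F' z \<in> UNIV \<and> F' (F z) = z \<and> F (F' z) = z"
        using finite_AutE[of UNIV g] o g 2 by metis
      obtain a b where ab: "a \<noteq> 0" "\<And>z. F z = a * z + b"
        using plane_automorphism[OF F(1,2)] F(3) by (metis UNIV_I)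
      then have "\<forall>x\<in>S. g x = moebius (mat2 a b 0 1) x" "det (mat2 a b 0 1) \<noteq> 0"
        using affine_moebius[of g a b] F(3) 2 by auto
      then show ?thesis by blast
    next
      case 3
      have "open (ball 0 1 :: complex set)" by simp
      then obtain G G' where G: "G holomorphic_on ball 0 1" "G' holomorphic_on ball 0 1"
        "\<forall>z\<in>ball 0 1. g (Some z) = Some (G z) \<and> G z \<in> ball 0 1 \<and> G' z \<in> ball 0 1 \<and>
           G' (G z) = z \<and> G (G' z) = z"
        using finite_AutE[of "ball 0 1" g] o g 3 by metis
      obtain \<alpha> a where a: "norm \<alpha> = 1" "norm a < 1"
        "\<And>z. norm z < 1 \<Longrightarrow> G z = (\<alpha> * z + a) / (1 + cnj a * \<alpha> * z)"
        by (rule disk_automorphism[OF G(1,2)]) (use G(3) in auto)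
      let ?A = "mat2 \<alpha> a (cnj a * \<alpha>) 1"
      have less: "norm (cnj a * \<alpha> * z) < 1" if "norm z < 1" for z
        using a that norm_mult_less[of a 1 z 1] by (simp add: norm_mult)
      have "det ?A = \<alpha> * (1 - of_real ((norm a)\<^sup>2))"
        unfolding complex_norm_square by (simp add: algebra_simps)
      moreover have "(norm a)\<^sup>2 < 1" using a(2) by (simp add: power_less_one_iff abs_square_less_1)
      ultimately have d: "det ?A \<noteq> 0" using a(1) 
        by (metis diff_eq_diff_eq diff_self less_irrefl mult_eq_0_iff norm_zero of_real_1 of_real_eq_iff right_minus_eq zero_neq_one)
      have "g (Some z) = moebius ?A (Some z)" if "norm z < 1" for z
      proof -
        have "cnj a * \<alpha> * z + 1 \<noteq> 0"
        proof
          assume "cnj a * \<alpha> * z + 1 = 0"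
          then have "cnj a * \<alpha> * z = -1" by (simp add: add_eq_0_iff2)
          then show False using less[OF that] by simp
        qed
        then show ?thesis using G(3) that a(3)[OF that]
          by (auto simp: moebius_Some proj_def add.commute)
      qed
      then have "\<forall>x\<in>S. g x = moebius ?A x" using 3 by auto
      then show ?thesis using d by blast
    qed
  qed
  then obtain A where A: "det A \<noteq> 0" "\<forall>x\<in>S. g x = moebius A x" by blast
  obtain B where B: "det B = 1" "moebius B = moebius A" using moebius_normalize[OF A(1)] .
  have "g \<in> extensional S" "g ` S = S" using g by (auto simp: Aut_def Bij_def bij_betw_def)
  then have "g = restrict (moebius B) S" "moebius B ` S = S"
    using A(2) B(2) by (auto simp: fun_eq_iff extensional_def)
  then show ?thesis using that B(1) by blast
qed

section \<open>Countability of fibres\<close>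

lemma Hausdorff_sphere: "Hausdorff_space sphere_top"
  by (simp add: Hausdorff_space_Alexandroff_compactification locally_compact_space_euclidean)

lemma openin_sphere_Compl_singleton: "openin sphere_top (- {a})"
proof -
  have "closedin sphere_top {a}"
    using Hausdorff_sphere by (intro closedin_Hausdorff_singleton) simp_all
  then show ?thesis by (simp add: closedin_def Compl_eq_Diff_UNIV)
qed

text \<open>Connectedness and sparseness are used in the plane only; infinity is treated separately
  by continuity.\<close>

definition finite_part :: "sphere set \<Rightarrow> complex set" where
  "finite_part S = Some -` S"

lemma finite_part_model:
  assumes "S \<in> model_surfaces"
  shows "open (finite_part S)" "connected (finite_part S)" "ball 0 1 \<subseteq> finite_part S"
proof -
  have "finite_part S = UNIV \<or> finite_part S = ball 0 1"
    using assms by (auto simp: model_surfaces_def finite_part_def)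
  then show "open (finite_part S)" "connected (finite_part S)" "ball 0 1 \<subseteq> finite_part S"
    by auto
qed

text \<open>If the germ \<open>L\<close> is not constant on a ball around \<open>z\<close>, then
  \<open>L - L z\<close> has an isolated zero at \<open>z\<close>. If the value at \<open>z\<close>
  is not \<open>a\<close>, continuity alone keeps \<open>f\<close> away from
  \<open>a\<close>.\<close>

lemma holomorphic_at_dichotomy:
  assumes f: "holomorphic_at f (Some z)"
  shows "(\<forall>\<^sub>F u in nhds z. f (Some u) = a) \<or> (\<forall>\<^sub>F u in at z. f (Some u) \<noteq> a)"
proof (cases "f (Some z) = a")
  case False
  have "openin sphere_top (- {a})" by (rule openin_sphere_Compl_singleton)
  then have "eventually (\<lambda>x. f x \<in> - {a}) (nhdsin sphere_top (Some z))"
    using f False unfolding holomorphic_at_iff limitin_def by blast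
  then have "\<forall>\<^sub>F u in nhds z. f (Some u) \<noteq> a"
    by (simp add: nhdsin_sphere eventually_filtermap)
  then show ?thesis by (simp add: eventually_nhds_conv_at)
next
  case True
  obtain L where L: "L analytic_on {z}" and ev: "\<forall>\<^sub>F u in nhds z. f (Some u) = unchart a (L u)"
    using f True by (auto simp: holomorphic_at_def represents_def)
  obtain r where r: "r > 0" "L holomorphic_on ball z r"
    using L by (auto simp: analytic_on_def)
  have "f (Some z) = unchart a (L z)" using ev by (rule eventually_nhds_x_imp_x)
  then have a: "unchart a (L z) = a" using True by simp
  show ?thesis
  proof (cases "\<exists>\<beta>\<in>ball z r. L \<beta> \<noteq> L z")
    case True
    then obtain \<beta> where \<beta>: "\<beta> \<in> ball z r" "L \<beta> - L z \<noteq> 0" by auto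
    have hol: "(\<lambda>u. L u - L z) holomorphic_on ball z r" using r by (intro holomorphic_intros)
    have "\<exists>e>0. \<forall>u\<in>ball z e - {z}. L u - L z \<noteq> 0"
      by (rule isolated_zeros[OF hol open_ball connected_ball _ _ \<beta>]) (use r in auto)
    then obtain e where e: "0 < e" "\<forall>u\<in>ball z e - {z}. L u \<noteq> L z" by auto
    have "\<forall>\<^sub>F u in at z. L u \<noteq> L z"
      unfolding eventually_at using e by (intro exI[of _ e]) (auto simp: dist_commute)
    moreover have "\<forall>\<^sub>F u in at z. f (Some u) = unchart a (L u)"
      using ev by (simp add: eventually_nhds_conv_at)
    ultimately have "\<forall>\<^sub>F u in at z. f (Some u) \<noteq> a"
      by eventually_elim (metis a chart_unchart)
    then show ?thesis ..
  next
    case False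
    have "\<forall>\<^sub>F u in nhds z. u \<in> ball z r" using r by (intro eventually_nhds_in_open) auto
    with ev have "\<forall>\<^sub>F u in nhds z. f (Some u) = a"
      by eventually_elim (use False a in auto)
    then show ?thesis ..
  qed
qed

text \<open>By the dichotomy the finite part of \<open>S\<close> splits into two disjoint open sets:
  \<open>E0\<close>, where \<open>w\<close> is locally equal to \<open>a\<close>, and
  \<open>E1\<close>, where the fibre is locally at most one point. Connectedness leaves only one of
  them; on \<open>E1\<close> the fibre is sparse, hence countable.\<close>

lemma countable_fibre:
  assumes S: "S \<in> model_surfaces" and w: "\<And>x. x \<in> S \<Longrightarrow> holomorphic_at w x"
    and nonconst: "\<not> (\<forall>x\<in>S. w x = a)"
  shows "countable {x \<in> S. w x = a}"
proof -
  let ?U = "finite_part S"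
  note U = finite_part_model[OF S]
  define E0 where "E0 = {z \<in> ?U. \<forall>\<^sub>F u in nhds z. w (Some u) = a}"
  define E1 where "E1 = {z \<in> ?U. \<forall>\<^sub>F u in at z. w (Some u) \<noteq> a}"
  have "open E0"
  proof (subst open_subopen, intro ballI)
    fix z assume z: "z \<in> E0"
    then obtain V where "open V" "z \<in> V" "\<forall>u\<in>V. w (Some u) = a"
      by (auto simp: E0_def eventually_nhds)
    then show "\<exists>T. open T \<and> z \<in> T \<and> T \<subseteq> E0"
      using U(1) z by (intro exI[of _ "V \<inter> ?U"]) (auto simp: E0_def eventually_nhds)
  qed
  moreover have "open E1"
  proof (subst open_subopen, intro ballI)
    fix z assume z: "z \<in> E1"
    then obtain V where V: "open V" "z \<in> V" "\<forall>u\<in>V. u \<noteq> z \<longrightarrow> w (Some u) \<noteq> a"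
      by (auto simp: E1_def eventually_at_topological)
    have "\<forall>\<^sub>F u in at y. w (Some u) \<noteq> a" if "y \<in> V" for y
    proof (cases "y = z")
      case False
      then show ?thesis unfolding eventually_at_topological
        using V that by (intro exI[of _ "V - {z}"]) auto
    qed (use z in \<open>simp add: E1_def\<close>)
    then show "\<exists>T. open T \<and> z \<in> T \<and> T \<subseteq> E1"
      using U(1) z V by (intro exI[of _ "V \<inter> ?U"]) (auto simp: E1_def)
  qed
  moreover have "?U \<subseteq> E0 \<union> E1"
    using holomorphic_at_dichotomy[OF w] by (auto simp: E0_def E1_def finite_part_def)
  moreover have "E0 \<inter> E1 \<inter> ?U = {}"
  proof -
    have False if "z \<in> E0" "z \<in> E1" for z
    proof -
      have "\<forall>\<^sub>F u in at z. w (Some u) = a" "\<forall>\<^sub>F u in at z. w (Some u) \<noteq> a"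
        using that by (auto simp: E0_def E1_def eventually_nhds_conv_at)
      then have "\<forall>\<^sub>F u in at z. False" by eventually_elim simp
      then show False by simp
    qed
    then show ?thesis by blast
  qed
  ultimately have "E0 \<inter> ?U = {} \<or> E1 \<inter> ?U = {}"
    using connectedD[OF U(2)] by blast
  then consider "?U \<subseteq> E1" | "?U \<subseteq> E0" using \<open>?U \<subseteq> E0 \<union> E1\<close> by blast
  then show ?thesis
  proof cases
    case 1
    have "{z. w (Some z) = a} sparse_in ?U"
      unfolding sparse_in_eventually_iff[OF U(1)] using 1 by (auto simp: E1_def)
    then have "countable (?U \<inter> {z. w (Some z) = a})"
      by (rule sparse_imp_countable[OF U(1)])
    moreover have "{x \<in> S. w x = a} \<subseteq> insert None (Some ` (?U \<inter> {z. w (Some z) = a}))"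
    proof
      fix x assume "x \<in> {x \<in> S. w x = a}"
      then show "x \<in> insert None (Some ` (?U \<inter> {z. w (Some z) = a}))"
        by (cases x) (auto simp: finite_part_def)
    qed
    ultimately show ?thesis by (meson countable_image countable_insert countable_subset)
  next
    case 2
    have fin: "w (Some z) = a" if "z \<in> ?U" for z
      using 2 that eventually_nhds_x_imp_x by (auto simp: E0_def)
    \<comment> \<open>Infinity is not isolated: if \<open>w\<close> had another value there, it
      would avoid \<open>a\<close> at nearby finite points as well, against
      \<open>fin\<close>.\<close>
    have "w None = a" if "None \<in> S"
    proof (rule ccontr)
      assume "w None \<noteq> a"
      then have "eventually (\<lambda>x. w x \<in> - {a}) (nhdsin sphere_top None)"
        using w[OF that] openin_sphere_Compl_singleton unfolding holomorphic_at_iff limitin_def by blast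
      moreover have "eventually (\<lambda>x. x \<in> S) (nhdsin sphere_top None)"
        using openin_model_surface[OF S] that by (auto simp: eventually_nhdsin)
      ultimately have "eventually (\<lambda>x. w x \<noteq> a \<and> x \<in> S) (nhdsin sphere_top None)"
        by eventually_elim simp
      then have "\<forall>\<^sub>F u in nhds 0. w (unchart None u) \<noteq> a \<and> unchart None u \<in> S"
        by (simp add: nhdsin_sphere eventually_filtermap)
      then obtain V where V: "open V" "0 \<in> V" "\<forall>u\<in>V. w (unchart None u) \<noteq> a \<and> unchart None u \<in> S"
        by (auto simp: eventually_nhds)
      have "V \<noteq> {0}" using V(1) not_open_singleton[of "0::complex"] by metis
      then obtain u where "u \<in> V" "u \<noteq> 0" using V(2) by blast
      then show False using V(3) fin by (auto simp: finite_part_def)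
    qed
    then have "\<forall>x\<in>S. w x = a" using fin by (metis finite_part_def option.exhaust vimageI)
    then show ?thesis using nonconst by blast
  qed
qed

lemma uncountable_circle: "uncountable {c::complex. norm c = 1}"
proof -
  have "connected (sphere (0::complex) 1)" by (rule connected_sphere) simp
  then have "uncountable (sphere (0::complex) 1)"
    by (rule connected_uncountable[of _ 1 "-1"]) auto
  moreover have "sphere (0::complex) 1 = {c. norm c = 1}" by auto
  ultimately show ?thesis by simp
qed

lemma infinite_values_on_circle:
  assumes S: "S \<in> model_surfaces" and w: "\<And>x. x \<in> S \<Longrightarrow> holomorphic_at w x"
    and nonconst: "\<And>a. \<not> (\<forall>x\<in>S. w x = a)"
    and z: "z \<noteq> 0" "\<And>c. norm c = 1 \<Longrightarrow> Some (c * z) \<in> S"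
  shows "infinite {w (Some (c * z)) | c. norm c = 1}"
proof
  let ?V = "{w (Some (c * z)) | c. norm c = 1}"
  assume "finite ?V"
  then have "countable (\<Union>a\<in>?V. {x \<in> S. w x = a})"
    using countable_fibre[OF S w nonconst] countable_finite by (intro countable_UN) auto
  moreover have "(\<lambda>c. Some (c * z)) ` {c. norm c = 1} \<subseteq> (\<Union>a\<in>?V. {x \<in> S. w x = a})"
    using z by auto
  ultimately have "countable ((\<lambda>c. Some (c * z)) ` {c. norm c = 1})"
    by (rule countable_subset[rotated])
  moreover have "inj_on (\<lambda>c. Some (c * z)) {c. norm c = 1}" using z(1) by (auto simp: inj_on_def)
  ultimately show False using uncountable_circle countable_image_inj_on by blast
qed

section \<open>Rotations, and nonconstancy of Speiser functions\<close>

definition rotation :: "complex \<Rightarrow> sphere \<Rightarrow> sphere" where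
  "rotation c = moebius (mat2 c 0 0 1)"

lemma rotation_Some [simp]: "rotation c (Some z) = Some (c * z)"
  by (simp add: rotation_def moebius_Some proj_def)

lemma rotation_None [simp]: "c \<noteq> 0 \<Longrightarrow> rotation c None = None"
  by (simp add: rotation_def moebius_None proj_def)

lemma rotation_in_Aut:
  assumes S: "S \<in> model_surfaces" and c: "norm c = 1"
  shows "restrict (rotation c) S \<in> Aut S"
proof -
  have c0: "c \<noteq> 0" using c by auto
  have sub: "rotation d x \<in> S" if "x \<in> S" "norm d = 1" for x d
  proof -
    have "d \<noteq> 0" using that by auto
    then show ?thesis using S that
      by (cases x) (auto simp: model_surfaces_def norm_mult)
  qed
  have "x \<in> rotation c ` S" if "x \<in> S" for x
  proof (rule image_eqI)
    show "rotation (inverse c) x \<in> S" using that c by (intro sub) (auto simp: norm_inverse)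
    show "x = rotation c (rotation (inverse c) x)" using c0 by (cases x) auto
  qed
  then have "rotation c ` S = S" using sub c by auto
  then show ?thesis
    unfolding rotation_def using c0 by (intro moebius_in_Aut openin_model_surface S) auto
qed

text \<open>The only possible singular value of a constant function is its own value, whereas at
  least two singular values are required.\<close>

lemma speiser_nonconstant:
  assumes S: "S \<in> model_surfaces" and w: "speiser_function S w"
  shows "\<not> (\<forall>x\<in>S. w x = a)"
proof
  assume const: "\<forall>x\<in>S. w x = a"
  have "asymptotic_values S w \<subseteq> {a}"
  proof
    fix b assume "b \<in> asymptotic_values S w"
    then obtain \<gamma> where \<gamma>: "continuous_map (top_of_set {0::real..}) (subtopology sphere_top S) \<gamma>"
      "limitin sphere_top (w \<circ> \<gamma>) b at_top" by (auto simp: asymptotic_values_def)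
    have "\<gamma> t \<in> S" if "t \<ge> 0" for t
      using \<gamma>(1) that by (auto simp: continuous_map_def Pi_iff)
    then have eq: "\<forall>\<^sub>F t in at_top. (w \<circ> \<gamma>) t = a"
      using const by (intro eventually_mono[OF eventually_ge_at_top[of "0::real"]]) auto
    moreover have ne: "\<forall>\<^sub>F t in at_top. (w \<circ> \<gamma>) t \<in> - {a}" if "b \<noteq> a"
      using \<gamma>(2) that openin_sphere_Compl_singleton unfolding limitin_def by blast
    ultimately have "\<forall>\<^sub>F t in (at_top :: real filter). False" if "b \<noteq> a"
    proof -
      from eq ne[OF that] show ?thesis by eventually_elim simp
    qed
    then show "b \<in> {a}" by auto
  qed
  moreover have "critical_values S w \<subseteq> {a}" using const by (auto simp: critical_values_def)
  ultimately have "singular_values S w \<subseteq> {a}" by (simp add: singular_values_def)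
  then have "card (singular_values S w) \<le> 1"
    using card_mono[of "{a}"] by simp
  then show False using w by (simp add: speiser_function_def)
qed

section \<open>Transport of Speiser functions\<close>

lemma continuous_map_holomorphic:
  assumes "openin sphere_top S" "\<And>x. x \<in> S \<Longrightarrow> holomorphic_at f x"
  shows "continuous_map (subtopology sphere_top S) sphere_top f"
  using assms by (simp add: continuous_map_iff_limitin holomorphic_at_iff)

lemma subtopology_sphere_UNIV: "subtopology sphere_top UNIV = sphere_top"
  using subtopology_topspace[of sphere_top] by simp

text \<open>Composed with its inverse \<open>k\<close>, the map is the identity near
  \<open>p\<close>, so by the chain rule the two derivatives have product 1.\<close>

lemma chart_deriv_Aut_nonzero:
  assumes S: "openin sphere_top S" and g: "g \<in> Aut S" and p: "p \<in> S"
  shows "chart_deriv g p \<noteq> 0"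
proof -
  obtain k where k: "\<forall>x\<in>S. g x \<in> S \<and> k x \<in> S \<and> k (g x) = x \<and> g (k x) = x \<and>
            holomorphic_at g x \<and> holomorphic_at k x"
    by (rule Aut_inverse[OF S g], erule that)
  have hol: "holomorphic_at g p" "holomorphic_at k (g p)" using k p by blast+
  have "chart_deriv k (g p) * chart_deriv g p = chart_deriv (k \<circ> g) p"
    using chart_deriv_compose[OF hol] by simp
  also have "\<dots> = chart_deriv id p"
    by (rule chart_deriv_cong[OF S p]) (use k holomorphic_at_compose[OF hol] in auto)
  finally show ?thesis using chart_deriv_id by auto
qed

context
  fixes S g h f
  assumes S: "S \<in> model_surfaces" and g: "g \<in> Aut S" and h: "h \<in> Aut UNIV"
    and f: "holomorphic_map_on S f"
begin

lemma holomorphic_at_transform: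
  assumes p: "p \<in> S"
  shows "holomorphic_at (transform S g h f) p"
    and "chart_deriv (transform S g h f) p =
      chart_deriv h (f (g p)) * (chart_deriv f (g p) * chart_deriv g p)"
proof -
  note o = openin_model_surface[OF S]
  obtain k where k: "\<forall>x\<in>S. g x \<in> S \<and> k x \<in> S \<and> k (g x) = x \<and> g (k x) = x \<and>
            holomorphic_at g x \<and> holomorphic_at k x"
    by (rule Aut_inverse[OF o g], erule that)
  obtain l where l: "\<forall>x\<in>UNIV. h x \<in> UNIV \<and> l x \<in> UNIV \<and> l (h x) = x \<and> h (l x) = x \<and>
            holomorphic_at h x \<and> holomorphic_at l x"
    by (rule Aut_inverse[OF openin_sphere_UNIV h], erule that)
  have hg: "holomorphic_at g p" and gp: "g p \<in> S" using k p by blast+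
  have hf: "holomorphic_at f (g p)" using f gp holomorphic_map_on_iff[OF o] by blast
  have hh: "holomorphic_at h (f (g p))" using l by blast
  have fg: "holomorphic_at (f \<circ> g) p" using holomorphic_at_compose[OF hg hf] .
  have hh': "holomorphic_at h ((f \<circ> g) p)" using hh by simp
  have hol: "holomorphic_at (h \<circ> (f \<circ> g)) p" by (rule holomorphic_at_compose[OF fg hh'])
  have eq: "\<And>x. x \<in> S \<Longrightarrow> (h \<circ> (f \<circ> g)) x = transform S g h f x"
    by (simp add: transform_def)
  show "holomorphic_at (transform S g h f) p"
    using holomorphic_at_cong[of S p "h \<circ> (f \<circ> g)", OF o p eq] hol by blast
  show "chart_deriv (transform S g h f) p =
      chart_deriv h (f (g p)) * (chart_deriv f (g p) * chart_deriv g p)"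
    using chart_deriv_cong[OF o p eq hol] chart_deriv_compose[OF fg hh'] chart_deriv_compose[OF hg hf]
    by (simp add: comp_def)
qed

lemma critical_values_transform: "critical_values S (transform S g h f) = h ` critical_values S f"
proof -
  note o = openin_model_surface[OF S]
  have im: "g ` S = S" using g by (auto simp: Aut_def Bij_def bij_betw_def)
  have iff: "chart_deriv (transform S g h f) p = 0 \<longleftrightarrow> chart_deriv f (g p) = 0" if "p \<in> S" for p
    using holomorphic_at_transform(2)[OF that] chart_deriv_Aut_nonzero[OF o g that]
      chart_deriv_Aut_nonzero[OF openin_sphere_UNIV h, of "f (g p)"] by simp
  have "critical_values S (transform S g h f) = {h (f (g p)) | p. p \<in> S \<and> chart_deriv f (g p) = 0}"
    unfolding critical_values_def using iff by (auto simp: transform_def)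
  also have "\<dots> = {h (f q) | q. q \<in> g ` S \<and> chart_deriv f q = 0}" by blast
  also have "\<dots> = h ` critical_values S f" unfolding im critical_values_def by blast
  finally show ?thesis .
qed

text \<open>An asymptotic path of \<open>f\<close> is pulled back by the inverse \<open>k\<close> of
  \<open>g\<close>. The new path escapes from a compact set \<open>K\<close> because the old one
  escapes from the compact image of \<open>K\<close> under \<open>g\<close>.\<close>

lemma asymptotic_values_transform_aux:
  assumes a: "a \<in> asymptotic_values S f"
  shows "h a \<in> asymptotic_values S (transform S g h f)"
proof -
  note o = openin_model_surface[OF S]
  obtain k where k: "\<forall>x\<in>S. g x \<in> S \<and> k x \<in> S \<and> k (g x) = x \<and> g (k x) = x \<and>
            holomorphic_at g x \<and> holomorphic_at k x"
    by (rule Aut_inverse[OF o g], erule that)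
  obtain l where l: "\<forall>x\<in>UNIV. h x \<in> UNIV \<and> l x \<in> UNIV \<and> l (h x) = x \<and> h (l x) = x \<and>
            holomorphic_at h x \<and> holomorphic_at l x"
    by (rule Aut_inverse[OF openin_sphere_UNIV h], erule that)
  obtain \<gamma> where \<gamma>: "continuous_map (top_of_set {0::real..}) (subtopology sphere_top S) \<gamma>"
    and esc: "\<And>K. compactin sphere_top K \<Longrightarrow> K \<subseteq> S \<Longrightarrow> \<forall>\<^sub>F t in at_top. \<gamma> t \<notin> K"
    and lim: "limitin sphere_top (f \<circ> \<gamma>) a at_top"
    using a unfolding asymptotic_values_def by blast
  have \<gamma>S: "\<gamma> t \<in> S" if "t \<ge> 0" for t
    using \<gamma> that by (auto simp: continuous_map_def Pi_iff)
  have ev0: "\<forall>\<^sub>F t in at_top. (0::real) \<le> t" by (rule eventually_ge_at_top)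
  have cg: "continuous_map (subtopology sphere_top S) sphere_top g"
    by (rule continuous_map_holomorphic[OF o]) (use k in blast)
  have ck: "continuous_map (subtopology sphere_top S) (subtopology sphere_top S) k"
    unfolding continuous_map_in_subtopology
    by (rule conjI[OF continuous_map_holomorphic[OF o]]) (use k in \<open>auto simp: Pi_iff\<close>)
  have "continuous_map (subtopology sphere_top UNIV) sphere_top h"
    by (rule continuous_map_holomorphic[OF openin_sphere_UNIV]) (use l in blast)
  then have ch: "continuous_map sphere_top sphere_top h" by (simp add: subtopology_sphere_UNIV)
  have "continuous_map (top_of_set {0::real..}) (subtopology sphere_top S) (k \<circ> \<gamma>)"
    using \<gamma> ck by (rule continuous_map_compose)
  moreover have "\<forall>\<^sub>F t in at_top. (k \<circ> \<gamma>) t \<notin> K" if K: "compactin sphere_top K" "K \<subseteq> S" for K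
  proof -
    have "compactin (subtopology sphere_top S) K" using K by (simp add: compactin_subtopology)
    then have "compactin sphere_top (g ` K)" using cg by (rule image_compactin)
    moreover have "g ` K \<subseteq> S" using K(2) k by blast
    ultimately have "\<forall>\<^sub>F t in at_top. \<gamma> t \<notin> g ` K" by (rule esc)
    with ev0 show ?thesis
    proof eventually_elim
      case (elim t)
      then show ?case using k \<gamma>S by (metis comp_apply imageI)
    qed
  qed
  moreover have "limitin sphere_top (transform S g h f \<circ> (k \<circ> \<gamma>)) (h a) at_top"
  proof (rule limitin_transform_eventually)
    show "limitin sphere_top (h \<circ> (f \<circ> \<gamma>)) (h a) at_top"
      using ch lim by (rule continuous_map_limit)
    show "\<forall>\<^sub>F t in at_top. (h \<circ> (f \<circ> \<gamma>)) t = (transform S g h f \<circ> (k \<circ> \<gamma>)) t"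
      using ev0 by eventually_elim (use k \<gamma>S in \<open>simp add: transform_def\<close>)
  qed
  ultimately show ?thesis unfolding asymptotic_values_def by blast
qed

end

text \<open>Needed because undoing a transform returns \<open>f\<close> on \<open>S\<close> only,
  transforms being extensional. Asymptotic paths stay in \<open>S\<close> at all times
  \<open>t \<ge> 0\<close>, so values elsewhere do not count.\<close>

lemma asymptotic_values_cong_aux:
  assumes "\<And>x. x \<in> S \<Longrightarrow> f x = f' x"
  shows "asymptotic_values S f \<subseteq> asymptotic_values S f'"
proof
  fix a assume "a \<in> asymptotic_values S f"
  then obtain \<gamma> where \<gamma>: "continuous_map (top_of_set {0::real..}) (subtopology sphere_top S) \<gamma>"
    "\<forall>K. compactin sphere_top K \<and> K \<subseteq> S \<longrightarrow> (\<forall>\<^sub>F t in at_top. \<gamma> t \<notin> K)"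
    "limitin sphere_top (f \<circ> \<gamma>) a at_top"
    unfolding asymptotic_values_def by blast
  have "\<gamma> t \<in> S" if "t \<ge> 0" for t
    using \<gamma>(1) that by (auto simp: continuous_map_def Pi_iff)
  then have "\<forall>\<^sub>F t in at_top. (f \<circ> \<gamma>) t = (f' \<circ> \<gamma>) t"
    using assms by (intro eventually_mono[OF eventually_ge_at_top[of "0::real"]]) auto
  then have "limitin sphere_top (f' \<circ> \<gamma>) a at_top"
    using \<gamma>(3) by (rule limitin_transform_eventually)
  then show "a \<in> asymptotic_values S f'" unfolding asymptotic_values_def using \<gamma>(1,2) by blast
qed

lemma holomorphic_map_on_transform:
  assumes "S \<in> model_surfaces" "g \<in> Aut S" "h \<in> Aut UNIV" "holomorphic_map_on S f"
  shows "holomorphic_map_on S (transform S g h f)"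
  using holomorphic_at_transform(1)[OF assms]
  by (simp add: holomorphic_map_on_iff[OF openin_model_surface[OF assms(1)]])

lemma asymptotic_values_transform:
  assumes S: "S \<in> model_surfaces" and g: "g \<in> Aut S" and h: "h \<in> Aut UNIV"
    and f: "holomorphic_map_on S f"
  shows "asymptotic_values S (transform S g h f) = h ` asymptotic_values S f"
proof
  note o = openin_model_surface[OF S]
  obtain k where kA: "k \<in> Aut S" and k: "\<forall>x\<in>S. g x \<in> S \<and> k x \<in> S \<and> k (g x) = x \<and> g (k x) = x \<and>
            holomorphic_at g x \<and> holomorphic_at k x"
    by (rule Aut_inverse[OF o g], erule (1) that)
  obtain l where lA: "l \<in> Aut UNIV" and l: "\<forall>x\<in>UNIV. h x \<in> UNIV \<and> l x \<in> UNIV \<and> l (h x) = x \<and> h (l x) = x \<and>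
            holomorphic_at h x \<and> holomorphic_at l x"
    by (rule Aut_inverse[OF openin_sphere_UNIV h], erule (1) that)
  show "asymptotic_values S (transform S g h f) \<subseteq> h ` asymptotic_values S f"
  proof
    fix b assume "b \<in> asymptotic_values S (transform S g h f)"
    \<comment> \<open>The reverse inclusion is the one already shown, applied to the inverse pair
      \<open>k\<close>, \<open>l\<close>.\<close>
    then have "l b \<in> asymptotic_values S (transform S k l (transform S g h f))"
      by (rule asymptotic_values_transform_aux[OF S kA lA holomorphic_map_on_transform[OF assms]])
    also have "\<dots> \<subseteq> asymptotic_values S f"
      by (rule asymptotic_values_cong_aux) (use k l in \<open>simp add: transform_def\<close>)
    finally show "b \<in> h ` asymptotic_values S f" using l by (metis UNIV_I imageI)
  qed
qed (use asymptotic_values_transform_aux[OF assms] in blast)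

lemma singular_values_transform:
  assumes "S \<in> model_surfaces" "g \<in> Aut S" "h \<in> Aut UNIV" "holomorphic_map_on S f"
  shows "singular_values S (transform S g h f) = h ` singular_values S f"
  unfolding singular_values_def critical_values_transform[OF assms]
    asymptotic_values_transform[OF assms] by blast

lemma homeomorphic_map_moebius:
  assumes "det A \<noteq> 0"
  shows "homeomorphic_map sphere_top sphere_top (moebius A)"
proof -
  have "continuous_map sphere_top sphere_top (moebius B)" if "det B \<noteq> 0" for B
    using continuous_map_holomorphic[OF openin_sphere_UNIV holomorphic_at_moebius[OF that]]
    by (simp add: subtopology_sphere_UNIV)
  then have "homeomorphic_maps sphere_top sphere_top (moebius A) (moebius (adj A))"
    using assms by (simp add: homeomorphic_maps_def)
  then show ?thesis using homeomorphic_maps_map by blast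
qed

text \<open>The automorphism \<open>g\<close> is the restriction of a Moebius map of the sphere, which permutes the
  boundary points and carries meromorphic extensions of one function to those of the other.\<close>

lemma natural_boundary_transform:
  assumes S: "S \<in> model_surfaces" and g: "g \<in> Aut S" and h: "h \<in> Aut UNIV"
    and nb: "natural_boundary S f"
  shows "natural_boundary S (transform S g h f)"
  unfolding natural_boundary_def
proof (intro ballI notI)
  obtain A where A: "det A = 1" "g = restrict (moebius A) S" "moebius A ` S = S"
    using Aut_moebius[OF S g] .
  then have d: "det A \<noteq> 0" by simp
  note hom = homeomorphic_map_moebius[OF d]
  obtain l where l: "\<forall>x\<in>UNIV. h x \<in> UNIV \<and> l x \<in> UNIV \<and> l (h x) = x \<and> h (l x) = x \<and>
            holomorphic_at h x \<and> holomorphic_at l x"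
    by (rule Aut_inverse[OF openin_sphere_UNIV h], erule that)
  fix \<zeta> assume \<zeta>: "\<zeta> \<in> sphere_top frontier_of S"
  assume "\<exists>U F. openin sphere_top U \<and> \<zeta> \<in> U \<and> holomorphic_map_on U F \<and>
                 (\<forall>z \<in> U \<inter> S. F z = transform S g h f z)"
  then obtain U F where U: "openin sphere_top U" "\<zeta> \<in> U" and F: "holomorphic_map_on U F"
    and eq: "\<And>z. z \<in> U \<Longrightarrow> z \<in> S \<Longrightarrow> F z = transform S g h f z" by blast
  let ?U = "moebius A ` U" and ?F = "l \<circ> (F \<circ> moebius (adj A))"
  have oU: "openin sphere_top ?U"
    using homeomorphic_map_openness[OF hom, of U] U(1) by simp
  have "moebius A \<zeta> \<in> sphere_top frontier_of S"
    using homeomorphic_map_frontier_of[OF hom, of S] \<zeta> A(3) by auto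
  moreover have "moebius A \<zeta> \<in> ?U" using U by blast
  moreover have "holomorphic_map_on ?U ?F"
    unfolding holomorphic_map_on_iff[OF oU]
  proof
    fix y assume "y \<in> ?U"
    then have "moebius (adj A) y \<in> U" using d by auto
    then have "holomorphic_at F (moebius (adj A) y)" using F holomorphic_map_on_iff[OF U(1)] by blast
    then have "holomorphic_at (F \<circ> moebius (adj A)) y"
      using holomorphic_at_moebius[of "adj A" y] d by (intro holomorphic_at_compose) auto
    from holomorphic_at_compose[OF this, of l] show "holomorphic_at ?F y" using l by simp
  qed
  moreover have "\<forall>y \<in> ?U \<inter> S. ?F y = f y"
  proof
    fix y assume y: "y \<in> ?U \<inter> S"
    then have "moebius (adj A) y \<in> U" using d by auto
    moreover have "moebius (adj A) y \<in> S" using y A(3) d by (metis IntD2 imageE moebius_adj(1))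
    ultimately show "?F y = f y" using eq l A(2) d by (simp add: transform_def)
  qed
  ultimately show False using nb oU unfolding natural_boundary_def by blast
qed

lemma inj_Aut_UNIV: "h \<in> Aut UNIV \<Longrightarrow> inj h"
  by (simp add: Aut_def Bij_def bij_betw_def)

lemma speiser_function_transform:
  assumes S: "S \<in> model_surfaces" and g: "g \<in> Aut S" and h: "h \<in> Aut UNIV"
    and f: "speiser_function S f"
  shows "speiser_function S (transform S g h f)"
proof -
  have hol: "holomorphic_map_on S f" using f by (simp add: speiser_function_def)
  have "inj_on h (singular_values S f)" using inj_Aut_UNIV[OF h] inj_on_subset by blast
  then show ?thesis
    using f holomorphic_map_on_transform[OF S g h hol] natural_boundary_transform[OF S g h]
    by (simp add: speiser_function_def singular_values_transform[OF S g h hol] card_image)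
qed

section \<open>The stabilizer of a cyclic order\<close>

lemma same_cyclic_order_refl: "same_cyclic_order xs xs"
  using rotate0 by (auto simp: same_cyclic_order_def intro: exI[of _ 0])

lemma same_cyclic_order_map: "same_cyclic_order us vs \<Longrightarrow> same_cyclic_order (map h us) (map h vs)"
  by (auto simp: same_cyclic_order_def rotate_map split: if_splits)

lemma same_cyclic_order_trans:
  assumes "same_cyclic_order us vs" "same_cyclic_order vs xs"
  shows "same_cyclic_order us xs"
  using assms by (auto simp: same_cyclic_order_def rotate_rotate split: if_splits)

lemma same_cyclic_order_sym:
  assumes "same_cyclic_order us vs"
  shows "same_cyclic_order vs us"
proof (cases "length vs = 2")
  case False
  then obtain k where k: "us = rotate k vs" using assms by (auto simp: same_cyclic_order_def)
  let ?n = "length vs"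
  \<comment> \<open>Modulo the length this is rotation by \<open>-k\<close>. The difference is not
    truncated, because \<open>?n\<close> is at least 1 for a nonempty list, and the total rotation
    \<open>?n * k\<close> is a multiple of the length.\<close>
  have "rotate (?n * k - k) us = rotate (?n * k - k + k) vs" by (simp add: k rotate_rotate)
  also have "\<dots> = vs"
  proof (cases "vs = []")
    case False
    then have "?n * k - k + k = ?n * k" by (cases ?n) auto
    then show ?thesis using rotate_conv_mod[of "?n * k" vs] by simp
  qed simp
  finally have "vs = rotate (?n * k - k) us" ..
  then show ?thesis using False k unfolding same_cyclic_order_def by (simp only: length_rotate if_False) blast
qed (use assms in \<open>auto simp: same_cyclic_order_def\<close>)

section \<open>Group structure of automorphisms and stabilizers\<close>

lemma Stab_subset_Aut: "Stab ws \<subseteq> Aut UNIV"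
  by (auto simp: Stab_def)

lemma BijGroup_simps:
  "carrier (BijGroup S) = Bij S" "\<one>\<^bsub>BijGroup S\<^esub> = (\<lambda>x\<in>S. x)"
  "g \<in> Bij S \<Longrightarrow> h \<in> Bij S \<Longrightarrow> g \<otimes>\<^bsub>BijGroup S\<^esub> h = compose S g h"
  by (simp_all add: BijGroup_def)

lemma Aut_subset_Bij: "Aut S \<subseteq> Bij S"
  by (auto simp: Aut_def)

lemma compose_UNIV: "compose UNIV g h = g \<circ> h"
  by (simp add: compose_def fun_eq_iff)

lemma AutGroup_simps [simp]:
  "carrier (AutGroup S) = Aut S" "\<one>\<^bsub>AutGroup S\<^esub> = (\<lambda>x\<in>S. x)"
  "g \<in> Aut S \<Longrightarrow> h \<in> Aut S \<Longrightarrow> g \<otimes>\<^bsub>AutGroup S\<^esub> h = compose S g h"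
  using Aut_subset_Bij by (auto simp: AutGroup_def BijGroup_def)

lemma StabGroup_simps [simp]:
  "carrier (StabGroup ws) = Stab ws" "\<one>\<^bsub>StabGroup ws\<^esub> = id"
  "g \<in> Stab ws \<Longrightarrow> h \<in> Stab ws \<Longrightarrow> g \<otimes>\<^bsub>StabGroup ws\<^esub> h = g \<circ> h"
proof -
  show "g \<otimes>\<^bsub>StabGroup ws\<^esub> h = g \<circ> h" if "g \<in> Stab ws" "h \<in> Stab ws"
  proof -
    have "g \<in> Aut UNIV" "h \<in> Aut UNIV" using that Stab_subset_Aut by blast+
    then have "g \<otimes>\<^bsub>AutGroup UNIV\<^esub> h = g \<circ> h" by (simp add: compose_UNIV)
    then show ?thesis by (simp add: StabGroup_def)
  qed
qed (auto simp: StabGroup_def AutGroup_def BijGroup_def)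

lemma id_in_Aut_UNIV: "id \<in> Aut UNIV"
  using moebius_in_Aut_UNIV[of "mat 1"] by (simp add: det_I)

lemma comp_in_Aut_UNIV: "g \<in> Aut UNIV \<Longrightarrow> h \<in> Aut UNIV \<Longrightarrow> g \<circ> h \<in> Aut UNIV"
  using compose_in_Aut[OF openin_sphere_UNIV] by (simp add: compose_UNIV)

lemma Aut_UNIV_inverse:
  assumes "h \<in> Aut UNIV"
  shows "inv_into UNIV h \<in> Aut UNIV" "\<And>x. inv_into UNIV h (h x) = x" "\<And>x. h (inv_into UNIV h x) = x"
proof -
  obtain A where A: "det A \<noteq> 0" "h = moebius A" using Aut_UNIV_moebius[OF assms] .
  have "inv_into UNIV h = moebius (adj A)"
    by (rule Hilbert_Choice.inv_equality) (use A in auto)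
  then show "inv_into UNIV h \<in> Aut UNIV" "\<And>x. inv_into UNIV h (h x) = x" "\<And>x. h (inv_into UNIV h x) = x"
    using A moebius_in_Aut_UNIV[of "adj A"] by auto
qed

lemma id_in_Stab: "id \<in> Stab ws"
  by (simp add: Stab_def id_in_Aut_UNIV same_cyclic_order_refl)

lemma comp_in_Stab:
  assumes "g \<in> Stab ws" "h \<in> Stab ws"
  shows "g \<circ> h \<in> Stab ws"
proof -
  have "same_cyclic_order (map g (map h ws)) (map g ws)" "same_cyclic_order (map g ws) ws"
    using assms by (auto simp: Stab_def simp del: map_map intro: same_cyclic_order_map)
  then have "same_cyclic_order (map (g \<circ> h) ws) ws"
    using same_cyclic_order_trans by (metis map_map)
  moreover have "(g \<circ> h) ` set ws = set ws"
    using assms by (simp only: Stab_def mem_Collect_eq image_comp[symmetric])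
  ultimately show ?thesis using assms by (simp add: Stab_def comp_in_Aut_UNIV)
qed

lemma inv_in_Stab:
  assumes h: "h \<in> Stab ws"
  shows "inv_into UNIV h \<in> Stab ws"
proof -
  have hA: "h \<in> Aut UNIV" using h by (simp add: Stab_def)
  note inv = Aut_UNIV_inverse[OF hA]
  have "same_cyclic_order (map (inv_into UNIV h) (map h ws)) (map (inv_into UNIV h) ws)"
    using h by (intro same_cyclic_order_map) (simp add: Stab_def)
  moreover have "map (inv_into UNIV h) (map h ws) = ws" using inv(2) by (simp add: map_idI)
  ultimately have "same_cyclic_order (map (inv_into UNIV h) ws) ws"
    using same_cyclic_order_sym by metis
  moreover have "inv_into UNIV h ` set ws = set ws"
  proof -
    have "inv_into UNIV h ` h ` set ws = set ws" using inv(2) by (simp add: image_image)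
    then show ?thesis using h by (simp add: Stab_def)
  qed
  ultimately show ?thesis using inv(1) by (simp add: Stab_def)
qed

lemma group_StabGroup: "Group.group (StabGroup ws)"
proof (rule groupI)
  show "\<exists>y\<in>carrier (StabGroup ws). y \<otimes>\<^bsub>StabGroup ws\<^esub> x = \<one>\<^bsub>StabGroup ws\<^esub>"
    if "x \<in> carrier (StabGroup ws)" for x
  proof (rule bexI)
    have x: "x \<in> Stab ws" using that by simp
    then have "x \<in> Aut UNIV" by (simp add: Stab_def)
    then have "inv_into UNIV x \<circ> x = id" using Aut_UNIV_inverse(2) by (simp add: fun_eq_iff)
    then show "inv_into UNIV x \<otimes>\<^bsub>StabGroup ws\<^esub> x = \<one>\<^bsub>StabGroup ws\<^esub>" using x inv_in_Stab[OF x] by simp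
  qed (use that inv_in_Stab in simp)
qed (auto simp: comp_in_Stab id_in_Stab comp_assoc)

lemma Aut_UNIV_eqI:
  assumes "g \<in> Aut UNIV" "h \<in> Aut UNIV" "p \<noteq> q" "q \<noteq> r" "p \<noteq> r" "g p = h p" "g q = h q" "g r = h r"
  shows "g = h"
proof -
  obtain A B where "det A \<noteq> 0" "g = moebius A" "det B \<noteq> 0" "h = moebius B"
    using assms Aut_UNIV_moebius by metis
  then show ?thesis using moebius_eqI[of A B p q r] assms by simp
qed

lemma three_elements:
  assumes "infinite V \<or> card V \<ge> 3"
  obtains p q r where "p \<in> V" "q \<in> V" "r \<in> V" "p \<noteq> q" "q \<noteq> r" "p \<noteq> r"
proof -
  obtain V' where V': "V' \<subseteq> V" "card V' = 3"
  proof (cases "finite V")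
    case True
    then show ?thesis using assms that obtain_subset_with_card_n by metis
  next
    case False
    then show ?thesis using that infinite_arbitrarily_large by metis
  qed
  then show ?thesis using that unfolding card_3_iff by auto
qed

lemma Aut_UNIV_eqI_on:
  assumes "g \<in> Aut UNIV" "h \<in> Aut UNIV" "infinite V \<or> card V \<ge> 3" "\<And>x. x \<in> V \<Longrightarrow> g x = h x"
  shows "g = h"
proof -
  obtain p q r where *: "p \<in> V" "q \<in> V" "r \<in> V" "p \<noteq> q" "q \<noteq> r" "p \<noteq> r"
    using three_elements[OF assms(3)] .
  show ?thesis by (rule Aut_UNIV_eqI[OF assms(1,2) *(4-6)]) (use assms(4) * in auto)
qed

lemma infinite_model_surface:
  assumes "S \<in> model_surfaces"
  shows "infinite S"
proof
  assume "finite S"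
  moreover have "Some ` ball 0 1 \<subseteq> S"
    using finite_part_model(3)[OF assms] by (auto simp: finite_part_def)
  ultimately have "finite (ball (0::complex) 1)"
    using finite_subset finite_imageD by (metis inj_Some inj_on_subset subset_UNIV)
  then show False using uncountable_ball[of 1 "0::complex"] countable_finite by auto
qed

section \<open>The product action is faithful\<close>

lemma faithful_product_action:
  assumes S: "S \<in> model_surfaces"
  shows "faithful_action (AutGroup S \<times>\<times> StabGroup ws) (S \<times> UNIV) (product_action S)"
proof -
  let ?G = "AutGroup S \<times>\<times> StabGroup ws" and ?E = "S \<times> (UNIV :: sphere set)"
  note o = openin_model_surface[OF S]
  have carrier: "carrier ?G = Aut S \<times> Stab ws" by (simp add: DirProd_def)
  have G: "Group.group ?G" by (intro DirProd_group group_AutGroup(2)[OF o] group_StabGroup)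
  have bij: "bij_betw g S S" "bij_betw h UNIV UNIV" if "g \<in> Aut S" "h \<in> Stab ws" for g h
    using that by (auto simp: Aut_def Bij_def Stab_def)
  have closed: "product_action S (g, h) \<in> Bij ?E" if gh: "g \<in> Aut S" "h \<in> Stab ws" for g h
  proof -
    have "bij_betw (map_prod g h) ?E (S \<times> UNIV)"
      using bij[OF gh] by (rule bij_betw_map_prod)
    then have "bij_betw (product_action S (g, h)) ?E ?E"
      by (rule bij_betw_cong[THEN iffD1, rotated]) (auto simp: product_action_def)
    then show ?thesis by (simp add: Bij_def product_action_def)
  qed
  have hom: "product_action S \<in> hom ?G (BijGroup ?E)"
  proof (rule homI)
    fix x assume "x \<in> carrier ?G"
    then show "product_action S x \<in> carrier (BijGroup ?E)"
      using closed by (cases x) (auto simp: carrier BijGroup_simps)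
  next
    fix x y assume x: "x \<in> carrier ?G" and y: "y \<in> carrier ?G"
    obtain g h g' h' where gh: "x = (g, h)" "y = (g', h')" by (cases x; cases y)
    have mem: "g \<in> Aut S" "h \<in> Stab ws" "g' \<in> Aut S" "h' \<in> Stab ws" using x y gh carrier by auto
    have g': "g' z \<in> S" if "z \<in> S" for z using bij(1)[OF mem(3,4)] that by (auto simp: bij_betw_def)
    have "x \<otimes>\<^bsub>?G\<^esub> y = (compose S g g', h \<circ> h')" using mem by (simp add: gh)
    then have "product_action S (x \<otimes>\<^bsub>?G\<^esub> y) = compose ?E (product_action S x) (product_action S y)"
      using g' by (auto simp: gh product_action_def compose_def fun_eq_iff)
    then show "product_action S (x \<otimes>\<^bsub>?G\<^esub> y) = product_action S x \<otimes>\<^bsub>BijGroup ?E\<^esub> product_action S y"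
      using closed mem gh by (simp add: BijGroup_simps)
  qed
  have "group_hom ?G (BijGroup ?E) (product_action S)"
    using G group_BijGroup hom by (simp add: group_hom_def group_hom_axioms_def)
  moreover have "inj_on (product_action S) (carrier ?G)"
  proof (rule inj_onI)
    fix x y assume x: "x \<in> carrier ?G" and y: "y \<in> carrier ?G"
      and eq: "product_action S x = product_action S y"
    obtain g h g' h' where gh: "x = (g, h)" "y = (g', h')" by (cases x; cases y)
    have mem: "g \<in> Aut S" "h \<in> Stab ws" "g' \<in> Aut S" "h' \<in> Stab ws" using x y gh carrier by auto
    have pt: "g z = g' z \<and> h v = h' v" if "z \<in> S" for z v
      using fun_cong[OF eq, of "(z, v)"] that by (simp add: gh product_action_def)
    \<comment> \<open>A point of \<open>S\<close> is needed to see the second factor: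
      \<open>h\<close> is read off from the images of the points (z0, v).\<close>
    obtain z0 where z0: "z0 \<in> S" using infinite_model_surface[OF S] by fastforce
    have "g = g'"
      by (rule extensionalityI[of _ S]) (use mem pt in \<open>auto simp: Aut_def Bij_def\<close>)
    moreover have "h = h'" using pt[OF z0] by auto
    ultimately show "x = y" by (simp add: gh)
  qed
  ultimately show ?thesis by (simp add: faithful_action_def group_action_def faithful_action_axioms_def)
qed

section \<open>Two singular values: the homotheties\<close>

lemma moebius_fix_0_infinity:
  assumes "h \<in> Aut UNIV" "h (Some 0) = Some 0" "h None = None"
  obtains c where "c \<noteq> 0" "h = map_option ((*) c)"
proof -
  obtain A where A: "det A \<noteq> 0" "h = moebius A" using Aut_UNIV_moebius[OF assms(1)] .
  have 1: "A$2$1 = 0" using assms(3) by (auto simp: A moebius_None proj_def split: if_splits)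
  have 2: "A$1$2 = 0" using assms(2) by (auto simp: A moebius_Some proj_def split: if_splits)
  have nz: "A$1$1 \<noteq> 0" "A$2$2 \<noteq> 0" using A(1) 1 2 by (auto simp: det_2)
  have "h x = map_option ((*) (A$1$1 / A$2$2)) x" for x
    using 1 2 nz by (cases x) (auto simp: A moebius_None moebius_Some proj_def)
  then show ?thesis using that[of "A$1$1 / A$2$2"] nz by auto
qed

lemma homothety_eq_moebius: "c \<noteq> 0 \<Longrightarrow> map_option ((*) c) = moebius (mat2 c 0 0 1)"
proof
  fix x assume "c \<noteq> 0"
  then show "map_option ((*) c) x = moebius (mat2 c 0 0 1) x"
    by (cases x) (auto simp: moebius_None moebius_Some proj_def)
qed

lemma moebius_to_0_infinity:
  assumes "p \<noteq> q"
  obtains m where "m \<in> Aut UNIV" "m p = Some 0" "m q = None"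
proof -
  obtain x y where p: "p = proj x y" "x \<noteq> 0 \<or> y \<noteq> 0" by (rule proj_cases)
  obtain x' y' where q: "q = proj x' y'" "x' \<noteq> 0 \<or> y' \<noteq> 0" by (rule proj_cases)
  have ne: "x * y' - y * x' \<noteq> 0"
  proof
    assume "x * y' - y * x' = 0"
    then have "p = q" using p q by (auto simp: proj_def field_simps)
    then show False using assms by simp
  qed
  \<comment> \<open>The rows are linear forms vanishing at [x : y] and at [x' : y'], so the
    numerator vanishes at \<open>p\<close> and the denominator at \<open>q\<close>. The determinant
    is nonzero because the points differ.\<close>
  let ?A = "mat2 y (- x) y' (- x')"
  have "det ?A \<noteq> 0" using ne by simp
  moreover have "moebius ?A p = Some 0" 
    unfolding p(1) moebius_proj[OF p(2)] using ne by (simp add: proj_def algebra_simps)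
  moreover have "moebius ?A q = None" 
    unfolding q(1) moebius_proj[OF q(2)] by (simp add: proj_def algebra_simps)
  ultimately show ?thesis using that moebius_in_Aut_UNIV by blast
qed

text \<open>The directed convention for two values rules out their exchange, so each of them is
  fixed.\<close>

lemma Stab_two:
  assumes "p \<noteq> q"
  shows "Stab [p, q] = {h \<in> Aut UNIV. h p = p \<and> h q = q}"
  by (auto simp: Stab_def same_cyclic_order_def)

lemma Stab_two_homotheties:
  assumes ws: "ws = [p, q]" "p \<noteq> q" and m: "m \<in> Aut UNIV" "m p = Some 0" "m q = None"
  shows "conjugate_by m (Stab ws) = homotheties"
proof -
  note inv = Aut_UNIV_inverse[OF m(1)]
  have inv_val: "inv_into UNIV m (Some 0) = p" "inv_into UNIV m None = q" using inv(2)[of p] inv(2)[of q] m by auto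
  show ?thesis
  proof (intro equalityI subsetI)
    fix k assume "k \<in> conjugate_by m (Stab ws)"
    then obtain h where h: "h \<in> Aut UNIV" "h p = p" "h q = q" "k = m \<circ> h \<circ> inv_into UNIV m"
      by (auto simp: conjugate_by_def ws Stab_two)
    have "k \<in> Aut UNIV" unfolding h using h m inv(1) by (intro comp_in_Aut_UNIV)
    then obtain c where "c \<noteq> 0" "k = map_option ((*) c)"
      by (rule moebius_fix_0_infinity) (use h m inv_val in auto)
    then show "k \<in> homotheties" by (auto simp: homotheties_def)
  next
    fix k assume "k \<in> homotheties"
    then obtain c where c: "c \<noteq> 0" "k = map_option ((*) c)" by (auto simp: homotheties_def)
    have kA: "k \<in> Aut UNIV" unfolding c(2) homothety_eq_moebius[OF c(1)] using c(1) by (intro moebius_in_Aut_UNIV) simp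
    have "inv_into UNIV m \<circ> k \<circ> m \<in> Stab ws"
      using comp_in_Aut_UNIV kA inv m inv_val by (simp add: ws Stab_two c(2))
    moreover have "k = m \<circ> (inv_into UNIV m \<circ> k \<circ> m) \<circ> inv_into UNIV m" using inv by (simp add: fun_eq_iff)
    ultimately show "k \<in> conjugate_by m (Stab ws)" unfolding conjugate_by_def by blast
  qed
qed

lemma Stab_two_iso:
  assumes m: "m \<in> Aut UNIV" and conj: "conjugate_by m (Stab ws) = homotheties"
  shows "StabGroup ws \<cong> Cstar"
proof -
  note inv = Aut_UNIV_inverse[OF m]
  \<comment> \<open>The conjugate of \<open>h\<close> is multiplication by a constant, which is its
    value at 1.\<close>
  define \<psi> where "\<psi> h = the (m (h (inv_into UNIV m (Some 1))))" for h
  have \<psi>: "\<psi> h \<noteq> 0 \<and> m \<circ> h \<circ> inv_into UNIV m = map_option ((*) (\<psi> h))" if h: "h \<in> Stab ws" for h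
  proof -
    have "m \<circ> h \<circ> inv_into UNIV m \<in> homotheties" unfolding conj[symmetric] conjugate_by_def using h by blast
    then obtain c where c: "c \<noteq> 0" "m \<circ> h \<circ> inv_into UNIV m = map_option ((*) c)" by (auto simp: homotheties_def)
    have "\<psi> h = c" using fun_cong[OF c(2), of "Some 1"] by (simp add: \<psi>_def)
    then show ?thesis using c by simp
  qed
  have rec: "h = inv_into UNIV m \<circ> (m \<circ> h \<circ> inv_into UNIV m) \<circ> m" for h using inv by (simp add: fun_eq_iff)
  have "\<psi> \<in> iso (StabGroup ws) Cstar"
  proof (rule isoI)
    show "\<psi> \<in> hom (StabGroup ws) Cstar"
    proof (rule homI)
      fix g h assume "g \<in> carrier (StabGroup ws)" "h \<in> carrier (StabGroup ws)"
      then have gh: "g \<in> Stab ws" "h \<in> Stab ws" by auto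
      have "m \<circ> (g \<circ> h) \<circ> inv_into UNIV m = (m \<circ> g \<circ> inv_into UNIV m) \<circ> (m \<circ> h \<circ> inv_into UNIV m)"
        using inv by (simp add: fun_eq_iff)
      then have "map_option ((*) (\<psi> (g \<circ> h))) (Some 1) = (map_option ((*) (\<psi> g)) \<circ> map_option ((*) (\<psi> h))) (Some 1)"
        using \<psi>[OF gh(1)] \<psi>[OF gh(2)] \<psi>[OF comp_in_Stab[OF gh]] by simp
      then show "\<psi> (g \<otimes>\<^bsub>StabGroup ws\<^esub> h) = \<psi> g \<otimes>\<^bsub>Cstar\<^esub> \<psi> h" using gh by (simp add: Cstar_def)
    qed (use \<psi> in \<open>simp add: Cstar_def\<close>)
    show "bij_betw \<psi> (carrier (StabGroup ws)) (carrier Cstar)"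
      unfolding bij_betw_def
    proof
      show "inj_on \<psi> (carrier (StabGroup ws))"
      proof (rule inj_onI)
        fix g h assume "g \<in> carrier (StabGroup ws)" "h \<in> carrier (StabGroup ws)" and eq: "\<psi> g = \<psi> h"
        then have "g \<in> Stab ws" "h \<in> Stab ws" by auto
        then have "m \<circ> g \<circ> inv_into UNIV m = m \<circ> h \<circ> inv_into UNIV m" using \<psi> eq by simp
        then show "g = h" using rec by metis
      qed
      show "\<psi> ` carrier (StabGroup ws) = carrier Cstar"
      proof (intro equalityI subsetI)
        fix c assume "c \<in> carrier Cstar"
        then have "map_option ((*) c) \<in> conjugate_by m (Stab ws)"
          unfolding conj by (auto simp: homotheties_def Cstar_def)
        then obtain h where h: "h \<in> Stab ws" "map_option ((*) c) = m \<circ> h \<circ> inv_into UNIV m"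
          by (auto simp: conjugate_by_def)
        have "m (h (inv_into UNIV m (Some 1))) = Some c" using fun_cong[OF h(2), of "Some 1"] by simp
        then have "c = \<psi> h" by (simp add: \<psi>_def)
        then show "c \<in> \<psi> ` carrier (StabGroup ws)" using h by auto
      qed (use \<psi> in \<open>auto simp: Cstar_def\<close>)
    qed
  qed
  then show ?thesis by (auto simp: is_iso_def)
qed

section \<open>PSL(2, C) and stabilizers of at least three values\<close>

lemma SL2C_simps [simp]:
  "carrier SL2C = {A. det A = 1}" "A \<otimes>\<^bsub>SL2C\<^esub> B = A ** B" "\<one>\<^bsub>SL2C\<^esub> = mat 1"
  by (simp_all add: SL2C_def)

lemma group_SL2C: "Group.group SL2C"
proof (rule groupI)
  fix A assume "A \<in> carrier SL2C"
  then have "adj A \<in> carrier SL2C" "adj A \<otimes>\<^bsub>SL2C\<^esub> A = \<one>\<^bsub>SL2C\<^esub>"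
    by (simp_all add: adj_mult mat_1_eq_mat2)
  then show "\<exists>B\<in>carrier SL2C. B \<otimes>\<^bsub>SL2C\<^esub> A = \<one>\<^bsub>SL2C\<^esub>" by blast
qed (auto simp: det_mul det_I matrix_mul_assoc)

lemma group_hom_moebius: "group_hom SL2C (AutGroup UNIV) moebius"
proof -
  have "moebius \<in> hom SL2C (AutGroup UNIV)"
  proof (rule homI)
    fix A B assume "A \<in> carrier SL2C" "B \<in> carrier SL2C"
    then have "moebius (A ** B) = moebius A \<circ> moebius B" "moebius A \<in> Aut UNIV" "moebius B \<in> Aut UNIV"
      by (auto simp: fun_eq_iff moebius_mult intro: moebius_in_Aut_UNIV)
    then show "moebius (A \<otimes>\<^bsub>SL2C\<^esub> B) = moebius A \<otimes>\<^bsub>AutGroup UNIV\<^esub> moebius B"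
      by (simp add: compose_UNIV)
  qed (auto intro: moebius_in_Aut_UNIV)
  then show ?thesis
    using group_SL2C group_AutGroup(2)[OF openin_sphere_UNIV]
    by (simp add: group_hom_def group_hom_axioms_def)
qed

lemma uminus_mat_1_eq_mat2: "- mat 1 = mat2 (-1) 0 0 (-1)"
  by (rule mat2_eqI) (simp_all add: mat_def)

lemma moebius_uminus_mat_1: "moebius (- mat 1) = id"
  unfolding uminus_mat_1_eq_mat2 by (rule ext) (simp add: moebius_scalar)

lemma kernel_moebius: "kernel SL2C (AutGroup UNIV) moebius = {mat 1, - mat 1}"
proof (intro equalityI subsetI)
  fix A assume "A \<in> kernel SL2C (AutGroup UNIV) moebius"
  then have A: "det A = 1" "moebius A = (\<lambda>x. x)" by (auto simp: kernel_def restrict_UNIV)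
  \<comment> \<open>Infinity, 0 and 1 serve as the three fixed points. The resulting scalar matrix
    has determinant 1, so its scalar is 1 or -1.\<close>
  have *: "A$1$2 = 0 \<and> A$2$1 = 0 \<and> A$2$2 = A$1$1"
    by (rule moebius_fixed_points[of A None "Some 0" "Some 1"]) (simp_all add: A)
  then have "(A$1$1)\<^sup>2 = 1" using A(1) by (simp add: det_2 power2_eq_square)
  then have "A$1$1 = 1 \<or> A$1$1 = -1" by (simp add: power2_eq_1_iff)
  then have "A = mat2 1 0 0 1 \<or> A = mat2 (-1) 0 0 (-1)"
    using * by (auto intro: mat2_eqI)
  then show "A \<in> {mat 1, - mat 1}" by (simp add: mat_1_eq_mat2 uminus_mat_1_eq_mat2[unfolded mat_1_eq_mat2])
next
  fix A :: "complex^2^2" assume "A \<in> {mat 1, - mat 1}"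
  moreover have "det (- mat 1 :: complex^2^2) = 1" unfolding uminus_mat_1_eq_mat2 by simp
  ultimately show "A \<in> kernel SL2C (AutGroup UNIV) moebius"
    by (auto simp: kernel_def restrict_UNIV det_I moebius_uminus_mat_1)
qed

text \<open>The map shared by the matrices of a coset. The form with \<open>the_elem\<close> is the
  one in which the first isomorphism theorem delivers its isomorphism, here from \<open>SL2C\<close>
  modulo the kernel of \<open>moebius\<close>.\<close>

definition PSL2C_map :: "(complex^2^2) set \<Rightarrow> sphere \<Rightarrow> sphere" where
  "PSL2C_map V = the_elem (moebius ` V)"

lemma moebius_image_SL2C: "moebius ` carrier SL2C = carrier (AutGroup UNIV)"
proof (intro equalityI subsetI)
  fix h assume "h \<in> carrier (AutGroup UNIV)"
  then obtain A where A: "det A \<noteq> 0" "h = moebius A" using Aut_UNIV_moebius by auto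
  obtain B where "det B = 1" "moebius B = moebius A" using moebius_normalize[OF A(1)] .
  then show "h \<in> moebius ` carrier SL2C" using A(2) by (intro image_eqI[of _ _ B]) simp_all
qed (auto intro: moebius_in_Aut_UNIV)

lemma PSL2C_map_iso: "PSL2C_map \<in> iso PSL2C (AutGroup UNIV)"
  using group_hom.FactGroup_iso_set[OF group_hom_moebius moebius_image_SL2C]
  by (simp add: PSL2C_def kernel_moebius PSL2C_map_def[abs_def])

lemma group_PSL2C: "Group.group PSL2C"
  unfolding PSL2C_def kernel_moebius[symmetric]
  by (intro normal.factorgroup_is_group group_hom.normal_kernel group_hom_moebius)

text \<open>The two matrices of a coset induce one map because \<open>- mat 1\<close> acts
  trivially. This identifies \<open>moebius_maps K\<close> with the set of values of
  \<open>PSL2C_map\<close> on \<open>K\<close>.\<close>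

lemma moebius_image_coset:
  assumes "V \<in> carrier PSL2C"
  shows "moebius ` V = {PSL2C_map V}"
proof -
  obtain A where A: "det A = 1" "V = {mat 1, - mat 1} #>\<^bsub>SL2C\<^esub> A"
    using assms by (auto simp: PSL2C_def carrier_FactGroup)
  then have "V = {mat 1 ** A, - mat 1 ** A}" by (auto simp: r_coset_def)
  moreover have "moebius (B ** A) = moebius B \<circ> moebius A" for B
    using A(1) by (simp add: fun_eq_iff moebius_mult)
  ultimately have "moebius ` V = {moebius A}" by (simp add: moebius_uminus_mat_1)
  then show ?thesis by (simp add: PSL2C_map_def)
qed

text \<open>An element is determined by the list of its values on \<open>ws\<close>, at least three
  distinct points, and only finitely many lists of that length have their entries in
  \<open>set ws\<close>.\<close>

lemma Stab_finite:
  assumes "distinct ws" "length ws \<ge> 3"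
  shows "finite (Stab ws)"
proof (rule inj_on_finite)
  show "inj_on (\<lambda>h. map h ws) (Stab ws)"
  proof (rule inj_onI)
    fix g h assume gh: "g \<in> Stab ws" "h \<in> Stab ws" "map g ws = map h ws"
    show "g = h"
      by (rule Aut_UNIV_eqI_on[of g h "set ws"])
        (use gh assms in \<open>auto simp: Stab_def distinct_card\<close>)
  qed
  show "(\<lambda>h. map h ws) ` Stab ws \<subseteq> {vs. set vs \<subseteq> set ws \<and> length vs = length ws}"
    by (auto simp: Stab_def)
qed (rule finite_lists_length_eq, simp)

lemma conjugate_by_id: "conjugate_by id H = H"
proof -
  have "inv_into UNIV id = id" by (rule Hilbert_Choice.inv_equality) auto
  then show ?thesis by (simp add: conjugate_by_def)
qed

text \<open>\<open>K\<close> is the preimage of \<open>Stab ws\<close> under the isomorphism from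
  \<open>PSL2C\<close> to the automorphism group of the sphere. Its maps are then exactly those of
  the stabilizer, so the identity serves as the conjugating map.\<close>

lemma Stab_finite_subgroup_PSL2C:
  assumes "distinct ws" "length ws \<ge> 3"
  shows "\<exists>K. subgroup K PSL2C \<and> finite K \<and> StabGroup ws \<cong> PSL2C\<lparr>carrier := K\<rparr> \<and>
           (\<exists>m \<in> Aut UNIV. conjugate_by m (Stab ws) = moebius_maps K)"
proof -
  interpret PSL: Group.group PSL2C by (rule group_PSL2C)
  interpret AG: Group.group "AutGroup UNIV" by (rule group_AutGroup(2)[OF openin_sphere_UNIV])
  have hom: "PSL2C_map \<in> hom PSL2C (AutGroup UNIV)" and
    bij: "bij_betw PSL2C_map (carrier PSL2C) (Aut UNIV)"
    using PSL2C_map_iso by (auto simp: iso_def)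
  interpret group_hom PSL2C "AutGroup UNIV" PSL2C_map
    by unfold_locales (rule hom)
  define K where "K = {V \<in> carrier PSL2C. PSL2C_map V \<in> Stab ws}"
  have bijK: "bij_betw PSL2C_map K (Stab ws)"
    unfolding bij_betw_def
  proof
    show "inj_on PSL2C_map K" using bij by (auto simp: bij_betw_def K_def inj_on_def)
    show "PSL2C_map ` K = Stab ws"
    proof (intro equalityI subsetI)
      fix h assume h: "h \<in> Stab ws"
      then have "h \<in> PSL2C_map ` carrier PSL2C" using bij Stab_subset_Aut by (auto simp: bij_betw_def)
      then show "h \<in> PSL2C_map ` K" using h by (auto simp: K_def)
    qed (auto simp: K_def)
  qed
  have mult: "PSL2C_map (V \<otimes>\<^bsub>PSL2C\<^esub> V') = PSL2C_map V \<circ> PSL2C_map V'"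
    if "V \<in> carrier PSL2C" "V' \<in> carrier PSL2C" for V V'
    using that hom_closed by (simp add: compose_UNIV)
  have sub: "subgroup K PSL2C"
  proof (rule PSL.subgroupI)
    have "\<one>\<^bsub>PSL2C\<^esub> \<in> K" using id_in_Stab hom_one by (simp add: K_def restrict_UNIV id_def)
    then show "K \<noteq> {}" by blast
    show "inv\<^bsub>PSL2C\<^esub> V \<in> K" if V: "V \<in> K" for V
    proof -
      have V': "V \<in> carrier PSL2C" "PSL2C_map V \<in> Stab ws" using V by (auto simp: K_def)
      then have A: "PSL2C_map V \<in> Aut UNIV" using Stab_subset_Aut by blast
      have "PSL2C_map (inv\<^bsub>PSL2C\<^esub> V) = inv\<^bsub>AutGroup UNIV\<^esub> (PSL2C_map V)" using V' by simp
      also have "\<dots> = inv_into UNIV (PSL2C_map V)"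
        by (rule AG.inv_equality) (use Aut_UNIV_inverse[OF A] A in \<open>auto simp: compose_UNIV fun_eq_iff\<close>)
      finally show ?thesis using V' inv_in_Stab by (simp add: K_def)
    qed
    show "V \<otimes>\<^bsub>PSL2C\<^esub> V' \<in> K" if "V \<in> K" "V' \<in> K" for V V'
      using that mult comp_in_Stab by (auto simp: K_def)
  qed (auto simp: K_def)
  have "PSL2C_map \<in> iso (PSL2C\<lparr>carrier := K\<rparr>) (StabGroup ws)"
  proof (rule isoI)
    show "PSL2C_map \<in> hom (PSL2C\<lparr>carrier := K\<rparr>) (StabGroup ws)"
      by (rule homI) (use mult in \<open>auto simp: K_def\<close>)
  qed (use bijK in simp)
  then have "PSL2C\<lparr>carrier := K\<rparr> \<cong> StabGroup ws" by (auto simp: is_iso_def)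
  then have iso: "StabGroup ws \<cong> PSL2C\<lparr>carrier := K\<rparr>"
    by (rule Group.group.iso_sym[OF PSL.subgroup_imp_group[OF sub]])
  have "moebius_maps K = (\<Union>V\<in>K. moebius ` V)" by (auto simp: moebius_maps_def)
  also have "\<dots> = PSL2C_map ` K" using moebius_image_coset by (auto simp: K_def)
  also have "\<dots> = conjugate_by id (Stab ws)" using bijK by (simp add: conjugate_by_id bij_betw_def)
  finally have "conjugate_by id (Stab ws) = moebius_maps K" ..
  moreover have "finite K" using bij_betw_finite[OF bijK] Stab_finite[OF assms] by simp
  ultimately show ?thesis using sub iso id_in_Aut_UNIV by blast
qed

section \<open>Nontrivial pairs and infinitely many functions\<close>

text \<open>Transitivity on the finite points, by a translation or a disk automorphism, with the
  addition that finite points stay finite. A second finite point thus gets an image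
  \<open>Some r\<close>, which rotations move along a circle around 0.\<close>

lemma Aut_to_0:
  assumes S: "S \<in> model_surfaces" and a: "Some a \<in> S"
  obtains k where "k \<in> Aut S" "k (Some a) = Some 0"
    "\<And>z. Some z \<in> S \<Longrightarrow> \<exists>y. k (Some z) = Some y"
proof -
  note o = openin_model_surface[OF S]
  show ?thesis
  proof (cases "S = Some ` ball 0 1")
    case False
    let ?A = "mat2 1 (- a) 0 1" and ?B = "mat2 1 a 0 1"
    have val: "moebius ?A (Some z) = Some (z - a)" "moebius ?A None = None"
      "moebius ?B (Some z) = Some (z + a)" "moebius ?B None = None" for z
      by (simp_all add: moebius_Some moebius_None proj_def)
    have S': "S = UNIV \<or> S = range Some" using S False by (auto simp: model_surfaces_def)
    have sub: "moebius ?A x \<in> S" "moebius ?B x \<in> S" "moebius ?A (moebius ?B x) = x" if "x \<in> S" for x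
      using S' that val by (cases x; auto)+
    have "moebius ?A ` S = S"
    proof (intro equalityI subsetI)
      fix x assume "x \<in> S"
      then show "x \<in> moebius ?A ` S" using sub by (metis image_eqI)
    qed (use sub in auto)
    then have "restrict (moebius ?A) S \<in> Aut S" by (intro moebius_in_Aut o) simp_all
    then show ?thesis by (rule that) (use a val in auto)
  next
    case True
    then have na: "norm a < 1" using a by auto
    \<comment> \<open>The matrix of \<open>Moebius_function 0 b\<close>, which sends
      \<open>b\<close> to 0 and has the function for \<open>-b\<close> as its inverse.\<close>
    define A where "A b = mat2 1 (- b) (- cnj b) 1" for b
    have val: "moebius (A b) (Some z) = Some (Moebius_function 0 b z)" if "norm b < 1" "norm z < 1" for b z
    proof -
      have "norm (cnj b * z) < 1" using norm_mult_less[of b 1 z 1] that by (simp add: norm_mult)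
      then have "1 - cnj b * z \<noteq> 0" by auto
      then show ?thesis by (simp add: A_def moebius_Some proj_def Moebius_function_simple algebra_simps)
    qed
    have na': "norm (-a) < 1" using na by simp
    have im: "moebius (A a) ` S = S"
    proof (intro equalityI subsetI)
      fix x assume "x \<in> moebius (A a) ` S"
      then show "x \<in> S" using True val[OF na] Moebius_function_norm_lt_1[OF na] by auto
    next
      fix x assume "x \<in> S"
      then obtain z where z: "x = Some z" "norm z < 1" using True by auto
      let ?y = "Moebius_function 0 (-a) z"
      have y: "norm ?y < 1" using Moebius_function_norm_lt_1[OF na' z(2)] .
      have "moebius (A a) (Some ?y) = x"
        using val[OF na y] Moebius_function_compose[of a "-a" z] na z by simp
      then show "x \<in> moebius (A a) ` S" using True y by force
    qed
    have "det (A a) = 1 - of_real ((norm a)\<^sup>2)"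
      unfolding complex_norm_square by (simp add: A_def)
    moreover have "(norm a)\<^sup>2 \<noteq> 1" using na abs_square_less_1[of "norm a"] by auto
    ultimately have "det (A a) \<noteq> 0" by (metis eq_iff_diff_eq_0 of_real_1 of_real_eq_iff)
    then have "restrict (moebius (A a)) S \<in> Aut S" using im by (intro moebius_in_Aut o)
    then show ?thesis
      by (rule that) (use a val[OF na] True in \<open>auto simp: Moebius_function_eq_zero\<close>)
  qed
qed

text \<open>It has to be excluded that only infinity or the preimage of infinity is moved. Without
  these two, infinitely many points of \<open>S\<close> remain; if all of them were fixed, the
  Moebius map would be the identity.\<close>

lemma Aut_moves_finite_point:
  assumes S: "S \<in> model_surfaces" and g: "g \<in> Aut S" "g \<noteq> (\<lambda>x\<in>S. x)"
  obtains z y where "Some z \<in> S" "g (Some z) = Some y" "y \<noteq> z"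
proof (rule ccontr)
  assume contra: "\<not> thesis"
  note obt = that
  have fixed: "y = z" if "Some z \<in> S" "g (Some z) = Some y" for z y
    using obt[OF that] contra by blast
  obtain A where A: "det A = 1" "g = restrict (moebius A) S" using Aut_moebius[OF S g(1)] .
  let ?V = "S - {None, moebius (adj A) None}"
  have "moebius A x = id x" if x: "x \<in> ?V" for x
  proof -
    have "moebius A x \<noteq> None" using x A(1) by (metis Diff_iff insertCI moebius_adj(1) zero_neq_one)
    then obtain y z where yz: "moebius A x = Some y" "x = Some z" using x by (cases x) auto
    then show ?thesis using fixed[of z y] A(2) x by simp
  qed
  moreover have "infinite ?V" using infinite_model_surface[OF S] by simp
  ultimately have "moebius A = id"
    using A(1) by (intro Aut_UNIV_eqI_on[OF moebius_in_Aut_UNIV id_in_Aut_UNIV, where V = ?V]) simp_all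
  then show False using A(2) g(2) by (simp add: id_def)
qed

lemma speiser_holomorphic_at:
  assumes "S \<in> model_surfaces" "speiser_function S w" "x \<in> S"
  shows "holomorphic_at w x"
  using assms holomorphic_map_on_iff[OF openin_model_surface[OF assms(1)]]
  by (simp add: speiser_function_def)

lemma speiser_infinite_on_circle:
  assumes "S \<in> model_surfaces" "speiser_function S w" "z \<noteq> 0" "\<And>c. norm c = 1 \<Longrightarrow> Some (c * z) \<in> S"
  shows "infinite {w (Some (c * z)) | c. norm c = 1}"
  using infinite_values_on_circle[OF assms(1) speiser_holomorphic_at[OF assms(1,2)]
      speiser_nonconstant[OF assms(1,2)] assms(3,4)] .

text \<open>The radius 1/2 serves all three surfaces at once: the circle has to lie in the unit disk
  and to avoid 0.\<close>

lemma half_in_model: "S \<in> model_surfaces \<Longrightarrow> norm c = 1 \<Longrightarrow> Some (c * (1/2)) \<in> S"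
  by (auto simp: model_surfaces_def norm_mult)

lemma infinite_range_speiser:
  assumes S: "S \<in> model_surfaces" and w: "speiser_function S w"
  shows "infinite (w ` S)"
proof -
  have "infinite {w (Some (c * (1/2))) | c. norm c = 1}"
    using speiser_infinite_on_circle[OF S w, of "1/2"] half_in_model[OF S] by simp
  moreover have "{w (Some (c * (1/2))) | c. norm c = 1} \<subseteq> w ` S" using half_in_model[OF S] by blast
  ultimately show ?thesis by (rule infinite_super[rotated])
qed

text \<open>If \<open>g\<close> moves \<open>z\<close> to \<open>y\<close>, choose \<open>k\<close> with \<open>k y = 0\<close>.  Replacing \<open>k\<close> by its rotations fixes
  \<open>k y\<close> and moves \<open>k z\<close> along a circle, on which \<open>w\<close> would have to be constant.\<close>

lemma transform_nontrivial:
  assumes S: "S \<in> model_surfaces" and w: "speiser_function S w"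
    and g: "g \<in> Aut S" and h: "h \<in> Aut UNIV" and nontriv: "g \<noteq> (\<lambda>x\<in>S. x) \<or> h \<noteq> id"
  shows "\<exists>k\<in>Aut S. transform S g h (transform S k id w) \<noteq> transform S k id w"
proof (rule ccontr)
  assume "\<not> ?thesis"
  then have inv: "transform S g h (transform S k id w) = transform S k id w" if "k \<in> Aut S" for k
    using that by blast
  have gS: "g x \<in> S" if "x \<in> S" for x using g that by (auto simp: Aut_def Bij_def bij_betw_def)
  have eq: "h (w (k (g x))) = w (k x)" if "k \<in> Aut S" "x \<in> S" for k x
    using fun_cong[OF inv[OF that(1)], of x] that(2) gS by (simp add: transform_def)
  show False
  proof (cases "g = (\<lambda>x\<in>S. x)")
    case True
    \<comment> \<open>With \<open>g\<close> trivial the identity serves as \<open>k\<close>,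
      obtained as an automorphism by rotating through 1. Then \<open>h\<close> fixes the infinitely
      many values of \<open>w\<close>, so it is trivial too.\<close>
    have "restrict (rotation 1) S \<in> Aut S" using rotation_in_Aut[OF S] by simp
    moreover have "rotation 1 = id"
      by (simp add: rotation_def flip: mat_1_eq_mat2)
    ultimately have id: "restrict id S \<in> Aut S" by simp
    have "h x = id x" if "x \<in> w ` S" for x
      using that eq[OF id] True by auto
    then have "h = id"
      using infinite_range_speiser[OF S w]
      by (intro Aut_UNIV_eqI_on[OF h id_in_Aut_UNIV, of "w ` S"]) auto
    then show False using nontriv True by simp
  next
    case False
    obtain z y where zy: "Some z \<in> S" "g (Some z) = Some y" "y \<noteq> z"
      using Aut_moves_finite_point[OF S g False] .
    have yS: "Some y \<in> S" using gS[OF zy(1)] zy(2) by simp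
    obtain k where k: "k \<in> Aut S" "k (Some y) = Some 0" "\<And>z. Some z \<in> S \<Longrightarrow> \<exists>y. k (Some z) = Some y"
      using Aut_to_0[OF S yS] by blast
    obtain r where r: "k (Some z) = Some r" using k(3)[OF zy(1)] by blast
    have kS: "bij_betw k S S" using k(1) by (simp add: Aut_def Bij_def)
    have "r \<noteq> 0"
    proof
      assume "r = 0"
      then have "Some z = Some y"
        using inj_onD[OF bij_betw_imp_inj_on[OF kS], of "Some z" "Some y"] k(2) r zy(1) yS by simp
      then show False using zy(3) by simp
    qed
    have rS: "Some r \<in> S" and "Some 0 \<in> S" using bij_betwE[OF kS] r zy(1) k(2) yS by force+
    have rot: "Some (c * r) \<in> S \<and> w (Some (c * r)) = h (w (Some 0))" if c: "norm c = 1" for c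
    proof
      have R: "restrict (rotation c) S \<in> Aut S" by (rule rotation_in_Aut[OF S c])
      then have "bij_betw (restrict (rotation c) S) S S" by (simp add: Aut_def Bij_def)
      then have "restrict (rotation c) S (Some r) \<in> S" using rS by (rule bij_betw_apply)
      then show "Some (c * r) \<in> S" using rS by simp
      have "compose S (restrict (rotation c) S) k \<in> Aut S"
        by (rule compose_in_Aut[OF openin_model_surface[OF S] R k(1)])
      from eq[OF this zy(1)] show "w (Some (c * r)) = h (w (Some 0))"
        using zy yS k(2) r rS \<open>Some 0 \<in> S\<close> by (simp add: compose_def)
    qed
    have "infinite {w (Some (c * r)) | c. norm c = 1}"
      using speiser_infinite_on_circle[OF S w \<open>r \<noteq> 0\<close>] rot by blast
    moreover have "{w (Some (c * r)) | c. norm c = 1} \<subseteq> {h (w (Some 0))}" using rot by blast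
    ultimately show False using finite_subset by blast
  qed
qed

lemma countable_transform_eq:
  assumes S: "S \<in> model_surfaces" and w: "speiser_function S w" and h: "h \<in> Aut UNIV"
  shows "countable {g \<in> Aut S. transform S g h w = restrict w S}" (is "countable ?G")
proof -
  obtain p q r where pqr: "p \<in> S" "q \<in> S" "r \<in> S" "p \<noteq> q" "q \<noteq> r" "p \<noteq> r"
    using three_elements[of S] infinite_model_surface[OF S] by blast
  note inv = Aut_UNIV_inverse[OF h]
  \<comment> \<open>The candidates for \<open>g x\<close>: invariance forces \<open>h\<close> to
    send \<open>w (g x)\<close> to \<open>w x\<close>, so they form a single fibre of
    \<open>w\<close>.\<close>
  define D where "D x = {y \<in> S. w y = inv_into UNIV h (w x)}" for x
  have D: "countable (D x)" for x
    unfolding D_def using countable_fibre[OF S speiser_holomorphic_at[OF S w]] speiser_nonconstant[OF S w]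
    by blast
  have val: "g x \<in> D x" if "g \<in> ?G" "x \<in> S" for g x
  proof -
    have g: "g \<in> Aut S" and eq: "transform S g h w = restrict w S" using that(1) by simp_all
    have "h (w (g x)) = w x" using fun_cong[OF eq, of x] that(2) by (simp add: transform_def)
    with g show ?thesis using inv(2)[of "w (g x)"] that(2) by (auto simp: D_def Aut_def Bij_def bij_betw_def)
  qed
  have "inj_on (\<lambda>g. (g p, g q, g r)) ?G"
  proof (rule inj_onI)
    fix g g' assume "g \<in> ?G" "g' \<in> ?G" and eq: "(g p, g q, g r) = (g' p, g' q, g' r)"
    then have "g \<in> Aut S" "g' \<in> Aut S" by simp_all
    obtain A where A: "det A = 1" "g = restrict (moebius A) S" using Aut_moebius[OF S \<open>g \<in> Aut S\<close>] .
    obtain B where B: "det B = 1" "g' = restrict (moebius B) S" using Aut_moebius[OF S \<open>g' \<in> Aut S\<close>] .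
    have "moebius A = moebius B"
      by (rule moebius_eqI[of A B p q r]) (use A B pqr eq in auto)
    then show "g = g'" using A B by simp
  qed
  moreover have "(\<lambda>g. (g p, g q, g r)) ` ?G \<subseteq> D p \<times> D q \<times> D r" using val pqr by blast
  moreover have "countable (D p \<times> D q \<times> D r)" using D by simp
  ultimately show ?thesis by (meson countable_image_inj_on countable_subset)
qed

lemma infinite_transforms:
  assumes S: "S \<in> model_surfaces" and w: "speiser_function S w"
  shows "infinite {transform S g id w | g. g \<in> Aut S}"
proof
  let ?p = "Some (1/2) :: sphere"
  assume "finite {transform S g id w | g. g \<in> Aut S}"
  then have "finite ((\<lambda>f. f ?p) ` {transform S g id w | g. g \<in> Aut S})" by (rule finite_imageI)
  \<comment> \<open>Evaluation at 1/2 tells enough functions apart: the transform by the rotation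
    through \<open>c\<close> has there the value of \<open>w\<close> at \<open>c/2\<close>.\<close>
  moreover have "{w (Some (c * (1/2))) | c. norm c = 1} \<subseteq> (\<lambda>f. f ?p) ` {transform S g id w | g. g \<in> Aut S}"
  proof
    fix v assume "v \<in> {w (Some (c * (1/2))) | c. norm c = 1}"
    then obtain c where c: "norm c = 1" "v = w (Some (c * (1/2)))" by blast
    have "v = transform S (restrict (rotation c) S) id w ?p"
      using half_in_model[OF S, of 1] c(2) by (simp add: transform_def)
    then show "v \<in> (\<lambda>f. f ?p) ` {transform S g id w | g. g \<in> Aut S}"
      using rotation_in_Aut[OF S c(1)] by blast
  qed
  ultimately have "finite {w (Some (c * (1/2))) | c. norm c = 1}" by (rule finite_subset[rotated])
  then show False
    using speiser_infinite_on_circle[OF S w, of "1/2"] half_in_model[OF S] by simp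
qed

theorem lemma5p19:
  fixes \<Omega> :: "sphere set" and w :: "sphere \<Rightarrow> sphere" and ws :: "sphere list"
  assumes "\<Omega> \<in> model_surfaces"
    and "speiser_function \<Omega> w"
    and "cyclic_order_of ws \<Omega> w"
  shows
    "faithful_action (AutGroup \<Omega> \<times>\<times> StabGroup ws) (\<Omega> \<times> UNIV) (product_action \<Omega>) \<and>
     (\<forall>g \<in> Aut \<Omega>. \<forall>h \<in> Stab ws.
        speiser_function \<Omega> (transform \<Omega> g h w) \<and>
        cyclic_order_of ws \<Omega> (transform \<Omega> g h w) \<and>
        cyclic_order_of (map h ws) \<Omega> (transform \<Omega> g h w) \<and>
        same_cyclic_order (map h ws) ws) \<and>
     (\<forall>g \<in> Aut \<Omega>. \<forall>h \<in> Stab ws.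
        (g, h) \<noteq> \<one>\<^bsub>AutGroup \<Omega> \<times>\<times> StabGroup ws\<^esub> \<longrightarrow>
        (\<exists>k \<in> Aut \<Omega>. \<exists>l \<in> Stab ws.
           transform \<Omega> g h (transform \<Omega> k l w) \<noteq> transform \<Omega> k l w)) \<and>
     (\<forall>g \<in> Aut \<Omega>. inj_on (\<lambda>h. transform \<Omega> g h w) (Stab ws)) \<and>
     (\<forall>h \<in> Stab ws. countable {g \<in> Aut \<Omega>. transform \<Omega> g h w = restrict w \<Omega>}) \<and>
     infinite {transform \<Omega> g id w | g. g \<in> Aut \<Omega>} \<and>
     (length ws = 2 \<and> Stab ws \<noteq> {id} \<longrightarrow>
        StabGroup ws \<cong> Cstar \<and>
        (\<exists>m \<in> Aut UNIV. conjugate_by m (Stab ws) = homotheties)) \<and>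
     (length ws \<ge> 3 \<and> Stab ws \<noteq> {id} \<longrightarrow>
        (\<exists>K. subgroup K PSL2C \<and> finite K \<and>
             StabGroup ws \<cong> PSL2C\<lparr>carrier := K\<rparr> \<and>
             (\<exists>m \<in> Aut UNIV. conjugate_by m (Stab ws) = moebius_maps K)))"
proof (intro conjI ballI impI)
  note S = assms(1) and w = assms(2)
  have hol: "holomorphic_map_on \<Omega> w" using w by (simp add: speiser_function_def)
  have ws: "distinct ws" "set ws = singular_values \<Omega> w" using assms(3) by (simp_all add: cyclic_order_of_def)
  show "faithful_action (AutGroup \<Omega> \<times>\<times> StabGroup ws) (\<Omega> \<times> UNIV) (product_action \<Omega>)"
    by (rule faithful_product_action[OF S])
  show "infinite {transform \<Omega> g id w | g. g \<in> Aut \<Omega>}" by (rule infinite_transforms[OF S w])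
  {
    fix g h assume g: "g \<in> Aut \<Omega>" and h: "h \<in> Stab ws"
    have hA: "h \<in> Aut UNIV" and hws: "h ` set ws = set ws" "same_cyclic_order (map h ws) ws"
      using h by (auto simp: Stab_def)
    have sing: "singular_values \<Omega> (transform \<Omega> g h w) = set ws"
      using singular_values_transform[OF S g hA hol] ws(2) hws(1) by simp
    show "speiser_function \<Omega> (transform \<Omega> g h w)" by (rule speiser_function_transform[OF S g hA w])
    show "cyclic_order_of ws \<Omega> (transform \<Omega> g h w)" using sing ws by (simp add: cyclic_order_of_def)
    have "inj_on h (set ws)" using inj_Aut_UNIV[OF hA] inj_on_subset by blast
    then show "cyclic_order_of (map h ws) \<Omega> (transform \<Omega> g h w)"
      using sing ws hws by (simp add: cyclic_order_of_def distinct_map)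
    show "same_cyclic_order (map h ws) ws" by (rule hws(2))
    assume "(g, h) \<noteq> \<one>\<^bsub>AutGroup \<Omega> \<times>\<times> StabGroup ws\<^esub>"
    then have "g \<noteq> (\<lambda>x\<in>\<Omega>. x) \<or> h \<noteq> id" by auto
    then show "\<exists>k \<in> Aut \<Omega>. \<exists>l \<in> Stab ws. transform \<Omega> g h (transform \<Omega> k l w) \<noteq> transform \<Omega> k l w"
      using transform_nontrivial[OF S w g hA] id_in_Stab by blast
  }
  show "inj_on (\<lambda>h. transform \<Omega> g h w) (Stab ws)" if g: "g \<in> Aut \<Omega>" for g
  proof (rule inj_onI)
    fix h h' assume hh': "h \<in> Stab ws" "h' \<in> Stab ws" and eq: "transform \<Omega> g h w = transform \<Omega> g h' w"
    \<comment> \<open>As \<open>g\<close> maps onto \<open>\<Omega>\<close>, equal transforms make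
      \<open>h\<close> and \<open>h'\<close> agree on all values of \<open>w\<close>, an infinite
      set.\<close>
    have im: "g ` \<Omega> = \<Omega>" using g by (auto simp: Aut_def Bij_def bij_betw_def)
    have "h (w (g x)) = h' (w (g x))" if "x \<in> \<Omega>" for x
      using fun_cong[OF eq, of x] that by (simp add: transform_def)
    then have "h (w x) = h' (w x)" if "x \<in> g ` \<Omega>" for x using that by blast
    then have "h v = h' v" if "v \<in> w ` \<Omega>" for v using that im by auto
    then show "h = h'"
      using hh' Stab_subset_Aut infinite_range_speiser[OF S w]
      by (intro Aut_UNIV_eqI_on[of h h' "w ` \<Omega>"]) auto
  qed
  show "countable {g \<in> Aut \<Omega>. transform \<Omega> g h w = restrict w \<Omega>}" if "h \<in> Stab ws" for h
    using countable_transform_eq[OF S w, of h] that by (simp add: Stab_def)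
  {
    assume "length ws = 2 \<and> Stab ws \<noteq> {id}"
    then obtain p q where pq: "ws = [p, q]"
      by (auto simp: numeral_2_eq_2 length_Suc_conv)
    then have "p \<noteq> q" using ws(1) by simp
    then obtain m where m: "m \<in> Aut UNIV" "m p = Some 0" "m q = None"
      by (rule moebius_to_0_infinity)
    have conj: "conjugate_by m (Stab ws) = homotheties"
      by (rule Stab_two_homotheties[OF pq \<open>p \<noteq> q\<close> m])
    show "StabGroup ws \<cong> Cstar" by (rule Stab_two_iso[OF m(1) conj])
    show "\<exists>m \<in> Aut UNIV. conjugate_by m (Stab ws) = homotheties" using m(1) conj by blast
  }
  show "\<exists>K. subgroup K PSL2C \<and> finite K \<and> StabGroup ws \<cong> PSL2C\<lparr>carrier := K\<rparr> \<and>
             (\<exists>m \<in> Aut UNIV. conjugate_by m (Stab ws) = moebius_maps K)"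
    if "length ws \<ge> 3 \<and> Stab ws \<noteq> {id}"
    using Stab_finite_subgroup_PSL2C[OF ws(1)] that by blast
qed

end
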